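(* Let $k\in\mathbb{Z}_+$ and let $a:\mathbb{R}_+\to\mathbb{C}$ be a bounded measurable function, regarded as the symbol $(u,v)\mapsto a(v)$ on $G$ (so it does not depend on $u$). Then the Calder\'on-Toeplitz operator $T_a^{(k)}$ acting on $A^{(k)}$ is unitarily equivalent to the multiplication operator $\gamma_{a,k}I$ acting on $L_2(\mathbb{R}_+)$, where $$\gamma_{a,k}(\xi)=\int_{\mathbb{R}_+}a\!\left(\frac{v}{2\xi}\right)\ell_k^2(v)\,\mathrm{d}v,\qquad \xi\in\mathbb{R}_+.$$
   Context: Let $G=\{(u,v):u\in\mathbb{R},\ v>0\}$ with the measure $\mathrm{d}\nu(u,v)=v^{-2}\,\mathrm{d}u\,\mathrm{d}v$; $\mathbb{R}_+=(0,\infty)$, $\mathbb{Z}_+=\{0,1,2,\dots\}$, $\chi_+$ is the indicator of $(0,\infty)$. The Fourier transform is $\hat g(\xi)=\int_{\mathbb{R}}g(x)e^{-2\pi i x\xi}\,\mathrm{d}x$. For $k\in\mathbb{Z}_+$, $L_k(x)=\sum_{i=0}^k(-1)^i\binom{k}{i}\frac{x^i}{i!}$ is the Laguerre polynomial and $\ell_k(x)=e^{-x/2}L_k(x)$. Let $\psi^{(k)}\in L_2(\mathbb{R})$ be defined by $\hat\psi^{(k)}(\xi)=\chi_+(\xi)\sqrt{2\xi}\,\ell_k(2\xi)$. Let $H_2^+(\mathbb{R})=\{h\in L_2(\mathbb{R}):\operatorname{supp}\hat h\subseteq[0,\infty)\}$. For $(u,v)\in G$ put $(\rho_{(u,v)}\psi)(x)=v^{-1/2}\psi((x-u)/v)$.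 The wavelet subspace is $A^{(k)}=\{(u,v)\mapsto\langle f,\rho_{(u,v)}\psi^{(k)}\rangle_{L_2(\mathbb{R})}: f\in H_2^+(\mathbb{R})\}$, a closed subspace of $L_2(G,\mathrm{d}\nu)$, and $P^{(k)}$ is the orthogonal projection of $L_2(G,\mathrm{d}\nu)$ onto $A^{(k)}$. For a bounded measurable function $a$ on $G$, the Calder\'on-Toeplitz operator $T_a^{(k)}:A^{(k)}\to A^{(k)}$ is $T_a^{(k)}F=P^{(k)}(aF)$. *)

theory Defs
  imports "HOL-Analysis.Analysis"
begin

definition laguerre :: "nat \<Rightarrow> real \<Rightarrow> real" where
  "laguerre k x = (\<Sum>i\<le>k. (-1)^i * real (k choose i) * x^i / fact i)"

definition lfun :: "nat \<Rightarrow> real \<Rightarrow> real" where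
  "lfun k x = exp (- x / 2) * laguerre k x"

definition L2 :: "'a measure \<Rightarrow> ('a \<Rightarrow> complex) \<Rightarrow> bool" where
  "L2 M f \<longleftrightarrow> f \<in> borel_measurable M \<and> integrable M (\<lambda>x. (cmod (f x))^2)"

definition L2inner :: "'a measure \<Rightarrow> ('a \<Rightarrow> complex) \<Rightarrow> ('a \<Rightarrow> complex) \<Rightarrow> complex" where
  "L2inner M f g = (LINT x|M. f x * cnj (g x))"

definition is_fourier :: "(real \<Rightarrow> complex) \<Rightarrow> (real \<Rightarrow> complex) \<Rightarrow> bool" where
  "is_fourier g h \<longleftrightarrow> L2 lborel g \<and> L2 lborel h \<and>
     ((\<lambda>R::real. \<integral>\<^sup>+ \<xi>. ennreal ((cmod (h \<xi> -
         (LINT x:{-R..R}|lborel. g x * exp (- 2 * complex_of_real pi * \<i> * complex_of_real x * complex_of_real \<xi>))))^2) \<partial>lborel)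
      \<longlongrightarrow> 0) at_top"

definition H2plus :: "(real \<Rightarrow> complex) set" where
  "H2plus = {h. L2 lborel h \<and> (\<exists>hh. is_fourier h hh \<and> (AE \<xi> in lborel. \<xi> < 0 \<longrightarrow> hh \<xi> = 0))}"

definition psi_hat :: "nat \<Rightarrow> real \<Rightarrow> complex" where
  "psi_hat k \<xi> = (if \<xi> > 0 then complex_of_real (sqrt (2 * \<xi>) * lfun k (2 * \<xi>)) else 0)"

text \<open>The group G = R x R_+ (pairs (u,v) with v>0) with measure v^-2 du dv;
  functions on G are represented on real x real, the complement having measure zero.\<close>
definition Gset :: "(real \<times> real) set" where
  "Gset = {p. snd p > 0}"

definition nuG :: "(real \<times> real) measure" where
  "nuG = density lborel (\<lambda>p. if snd p > 0 then ennreal (1 / (snd p)^2) else 0)"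

definition Rplus :: "real measure" where
  "Rplus = restrict_space lborel {0<..}"

definition wavelet_coeff :: "(real \<Rightarrow> complex) \<Rightarrow> (real \<Rightarrow> complex) \<Rightarrow> real \<times> real \<Rightarrow> complex" where
  "wavelet_coeff psi f p = (if snd p > 0 then
      (LINT x|lborel. f x * cnj (complex_of_real (snd p powr (-1/2)) * psi ((x - fst p) / snd p)))
    else 0)"

definition wavelet_space :: "(real \<Rightarrow> complex) \<Rightarrow> ((real \<times> real) \<Rightarrow> complex) set" where
  "wavelet_space psi = {F. \<exists>f\<in>H2plus. F = wavelet_coeff psi f}"

definition is_proj :: "((real \<times> real) \<Rightarrow> complex) set \<Rightarrow> ((real \<times> real) \<Rightarrow> complex) \<Rightarrow> ((real \<times> real) \<Rightarrow> complex) \<Rightarrow> bool" where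
  "is_proj A H P \<longleftrightarrow> P \<in> A \<and> (\<forall>F\<in>A. L2inner nuG (\<lambda>p. H p - P p) F = 0)"

definition calderon_toeplitz :: "((real \<times> real) \<Rightarrow> complex) set \<Rightarrow> (real \<Rightarrow> complex) \<Rightarrow> ((real \<times> real) \<Rightarrow> complex) \<Rightarrow> ((real \<times> real) \<Rightarrow> complex) \<Rightarrow> bool" where
  "calderon_toeplitz A a F TF \<longleftrightarrow> is_proj A (\<lambda>p. a (snd p) * F p) TF"

definition gamma_ak :: "(real \<Rightarrow> complex) \<Rightarrow> nat \<Rightarrow> real \<Rightarrow> complex" where
  "gamma_ak a k \<xi> = (LINT v:{0<..}|lborel. a (v / (2 * \<xi>)) * complex_of_real ((lfun k v)^2))"

definition unitarily_equiv_mult ::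
  "((real \<times> real) \<Rightarrow> complex) set \<Rightarrow> (((real \<times> real) \<Rightarrow> complex) \<Rightarrow> ((real \<times> real) \<Rightarrow> complex) \<Rightarrow> bool)
   \<Rightarrow> (real \<Rightarrow> complex) \<Rightarrow> bool" where
  "unitarily_equiv_mult A T g \<longleftrightarrow>
   (\<exists>U :: ((real \<times> real) \<Rightarrow> complex) \<Rightarrow> (real \<Rightarrow> complex).
      (\<forall>F\<in>A. L2 Rplus (U F)) \<and>
      (\<forall>F\<in>A. \<forall>F'\<in>A. \<forall>c. AE \<xi> in Rplus. U (\<lambda>p. F p + c * F' p) \<xi> = U F \<xi> + c * U F' \<xi>) \<and>
      (\<forall>F\<in>A. \<forall>F'\<in>A. L2inner Rplus (U F) (U F') = L2inner nuG F F') \<and>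
      (\<forall>h. L2 Rplus h \<longrightarrow> (\<exists>F\<in>A. AE \<xi> in Rplus. U F \<xi> = h \<xi>)) \<and>
      (\<forall>F\<in>A. \<forall>TF. T F TF \<longrightarrow> (AE \<xi> in Rplus. U TF \<xi> = g \<xi> * U F \<xi>)))"

end

theory Submission
  imports Defs "HOL-Probability.Probability"
begin

text \<open>
  On the Fourier side the wavelet transform of \<open>f\<close> at \<open>(u, v)\<close> is, for fixed \<open>v\<close>, the inverse Fourier
  transform in \<open>u\<close> of \<open>sqrt v * psi_hat k (v * \<xi>)\<close> times the transform \<open>h\<close> of \<open>f\<close>. Plancherel in \<open>u\<close>
  therefore turns the form \<open>\<langle>a F, F'\<rangle>\<close> on \<open>L\<^sub>2(G)\<close> into an integral of \<open>h * cnj h'\<close> against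
  \<open>a(v) psi_hat k (v * \<xi>)\<^sup>2 / v\<close>, and integrating out \<open>v\<close> leaves the weight \<open>gamma_ak a k \<xi>\<close>. For \<open>a = 1\<close>
  this weight is 1, so \<open>F \<mapsto> h\<close> is an isometry; for general \<open>a\<close> it shows that the compression of
  multiplication by \<open>a\<close> is multiplication by \<open>gamma_ak a k\<close>. Plancherel's identity itself comes from
  weighting the squared modulus of the transform with wide Gaussians: the resulting means are Gaussian
  averages of the autocorrelation, which is continuous at 0.
\<close>

section \<open>Square-integrable functions\<close>

text \<open>\<open>is_fourier\<close> is a relation between square-integrable functions, defined by
  a limit of truncated integrals. Two things must therefore be supplied. Parseval has to pass to
  such limits, so that wavelet coefficients can be rewritten; and every square-integrable function
  has to be a transform, which surjectivity of the unitary map requires and which rests on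
  completeness of L2. The function \<open>psi_hat k\<close> is both bounded and square-integrable,
  so for fixed \<open>v\<close> its dilate times \<open>h\<close> is integrable as well as
  square-integrable; each slice in \<open>u\<close> is then a transform given by an honest integral,
  to which the elementary Plancherel identity applies. The map from F back to \<open>h\<close> is a
  choice, unique only almost everywhere. The operator is known only through an orthogonality
  relation; its image is identified by testing that relation on a single element of the space, built
  from the difference between the expected and the actual answer.\<close>

definition sqn :: "'a measure \<Rightarrow> ('a \<Rightarrow> complex) \<Rightarrow> real" where
  "sqn M f = (LINT x|M. (cmod (f x))^2)"

lemma L2_integrable: "L2 M f \<Longrightarrow> integrable M (\<lambda>x. (cmod (f x))^2)"
  by (simp add: L2_def)

lemma sqn_nonneg: "0 \<le> sqn M f"
  by (simp add: sqn_def)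

lemma cmod_add_sq_le: "(cmod (a + b))^2 \<le> 2 * (cmod a)^2 + 2 * (cmod b)^2"
proof -
  have "(cmod (a + b))^2 \<le> (cmod a + cmod b)^2"
    by (simp add: norm_triangle_ineq power_mono)
  also have "\<dots> \<le> 2 * (cmod a)^2 + 2 * (cmod b)^2"
    using zero_le_power2[of "cmod a - cmod b"] by (simp add: power2_eq_square algebra_simps)
  finally show ?thesis .
qed

lemma L2_add:
  assumes "L2 M f" "L2 M g"
  shows "L2 M (\<lambda>x. f x + g x)"
proof -
  have [measurable]: "f \<in> borel_measurable M" "g \<in> borel_measurable M"
    using assms by (auto simp: L2_def)
  have "integrable M (\<lambda>x. 2 * (cmod (f x))^2 + 2 * (cmod (g x))^2)"
    using assms by (auto simp: L2_def)
  then have "integrable M (\<lambda>x. (cmod (f x + g x))^2)"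
    by (rule Bochner_Integration.integrable_bound) (auto simp: cmod_add_sq_le)
  then show ?thesis by (simp add: L2_def)
qed

lemma L2_scale:
  assumes "L2 M f"
  shows "L2 M (\<lambda>x. c * f x)"
  using assms by (auto simp: L2_def norm_mult power_mult_distrib)

lemma L2_diff:
  assumes "L2 M f" "L2 M g"
  shows "L2 M (\<lambda>x. f x - g x)"
  using L2_add[OF assms(1) L2_scale[OF assms(2), of "-1"]] by simp

lemma sqn_add_le:
  assumes "L2 M f" "L2 M g"
  shows "sqn M (\<lambda>x. f x + g x) \<le> 2 * sqn M f + 2 * sqn M g"
proof -
  have "sqn M (\<lambda>x. f x + g x) \<le> (LINT x|M. 2 * (cmod (f x))^2 + 2 * (cmod (g x))^2)"
    unfolding sqn_def
    by (rule integral_mono) (use assms L2_add[OF assms] in \<open>auto simp: L2_def cmod_add_sq_le\<close>)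
  also have "\<dots> = 2 * sqn M f + 2 * sqn M g"
    using assms by (simp add: L2_def sqn_def)
  finally show ?thesis .
qed

lemma L2_bounded_mult:
  assumes "L2 M f" "b \<in> borel_measurable M" "\<And>x. x \<in> space M \<Longrightarrow> cmod (b x) \<le> B"
  shows "L2 M (\<lambda>x. b x * f x)"
proof -
  have [measurable]: "f \<in> borel_measurable M" "b \<in> borel_measurable M"
    using assms by (auto simp: L2_def)
  have "integrable M (\<lambda>x. B^2 * (cmod (f x))^2)"
    using assms by (auto simp: L2_def)
  then have "integrable M (\<lambda>x. (cmod (b x * f x))^2)"
    by (rule Bochner_Integration.integrable_bound)
       (auto simp: norm_mult power_mult_distrib intro!: mult_right_mono power_mono assms)
  then show ?thesis by (simp add: L2_def)
qed

lemma cmod_mult_le: "cmod a * cmod b \<le> ((cmod a)^2 + (cmod b)^2) / 2"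
  using zero_le_power2[of "cmod a - cmod b"] by (simp add: power2_eq_square algebra_simps)

lemma L2_mult_integrable:
  assumes "L2 M f" "L2 M g"
  shows "integrable M (\<lambda>x. f x * g x)"
proof -
  have [measurable]: "f \<in> borel_measurable M" "g \<in> borel_measurable M"
    using assms by (auto simp: L2_def)
  have "integrable M (\<lambda>x. ((cmod (f x))^2 + (cmod (g x))^2) / 2)"
    using assms by (auto simp: L2_def)
  then show ?thesis
    by (rule Bochner_Integration.integrable_bound)
       (auto simp: norm_mult abs_mult cmod_mult_le simp del: divide_le_eq_numeral1 le_divide_eq_numeral1 intro!: AE_I2)
qed

lemma L2_cnj: "L2 M f \<Longrightarrow> L2 M (\<lambda>x. cnj (f x))"
  by (auto simp: L2_def intro: measurable_compose[OF _ borel_measurable_continuous_onI[OF continuous_on_cnj[OF continuous_on_id]]])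

lemma L2inner_integrable:
  assumes "L2 M f" "L2 M g"
  shows "integrable M (\<lambda>x. f x * cnj (g x))"
  by (intro L2_mult_integrable L2_cnj assms)

lemma L2inner_self: "L2inner M f f = of_real (sqn M f)"
  unfolding L2inner_def sqn_def complex_norm_square[symmetric] by (simp del: of_real_power)

lemma nn_integral_cmod_sq:
  assumes "L2 M f"
  shows "(\<integral>\<^sup>+x. ennreal ((cmod (f x))^2) \<partial>M) = ennreal (sqn M f)"
  unfolding sqn_def by (rule nn_integral_eq_integral[OF L2_integrable[OF assms]]) simp

text \<open>The Cauchy-Schwarz inequality for extended nonnegative integrals, applied to the moduli;
  the squared form avoids square roots.\<close>

lemma L2_CS:
  assumes "L2 M f" "L2 M g"
  shows "(cmod (L2inner M f g))^2 \<le> sqn M f * sqn M g"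
proof -
  have [measurable]: "f \<in> borel_measurable M" "g \<in> borel_measurable M"
    using assms by (auto simp: L2_def)
  have i: "integrable M (\<lambda>x. f x * cnj (g x))"
    by (rule L2inner_integrable[OF assms])
  have "cmod (L2inner M f g) \<le> (LINT x|M. cmod (f x) * cmod (g x))"
    unfolding L2inner_def using integral_norm_bound[of M "\<lambda>x. f x * cnj (g x)"]
    by (simp add: norm_mult)
  then have "ennreal (cmod (L2inner M f g)) \<le> ennreal (LINT x|M. cmod (f x) * cmod (g x))"
    by (rule ennreal_leI)
  also have "\<dots> = (\<integral>\<^sup>+x. ennreal (cmod (f x)) * ennreal (cmod (g x)) \<partial>M)"
    using nn_integral_eq_integral[of M "\<lambda>x. cmod (f x) * cmod (g x)"] integrable_norm[OF i]
    by (simp add: norm_mult ennreal_mult)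
  finally have "ennreal (cmod (L2inner M f g)) \<le> (\<integral>\<^sup>+x. ennreal (cmod (f x)) * ennreal (cmod (g x)) \<partial>M)" .
  then have "(ennreal (cmod (L2inner M f g)))^2 \<le> (\<integral>\<^sup>+x. ennreal (cmod (f x)) * ennreal (cmod (g x)) \<partial>M)^2"
    by (rule power_mono) simp
  also have "\<dots> \<le> (\<integral>\<^sup>+x. (ennreal (cmod (f x)))^2 \<partial>M) * (\<integral>\<^sup>+x. (ennreal (cmod (g x)))^2 \<partial>M)"
    by (rule Cauchy_Schwarz_nn_integral) auto
  also have "\<dots> = ennreal (sqn M f * sqn M g)"
    using nn_integral_cmod_sq[OF assms(1)] nn_integral_cmod_sq[OF assms(2)]
    by (simp add: ennreal_power ennreal_mult sqn_nonneg)
  finally show ?thesis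
    by (simp add: ennreal_power sqn_nonneg)
qed

lemma L2inner_diff_left:
  assumes "L2 M f" "L2 M f'" "L2 M g"
  shows "L2inner M (\<lambda>x. f x - f' x) g = L2inner M f g - L2inner M f' g"
  unfolding L2inner_def
  by (simp add: left_diff_distrib L2inner_integrable assms)

lemma L2inner_diff_right:
  assumes "L2 M f" "L2 M g" "L2 M g'"
  shows "L2inner M f (\<lambda>x. g x - g' x) = L2inner M f g - L2inner M f g'"
  unfolding L2inner_def
  by (simp add: right_diff_distrib L2inner_integrable assms)

text \<open>The difference splits into one part for each argument, with Cauchy-Schwarz on both; the
  norms of \<open>g n\<close> stay bounded because those of \<open>g n - g'\<close> and
  \<open>g'\<close> control them. The filter is general since limits are taken along sequences and
  over a real truncation radius.\<close>

lemma tendsto_L2inner: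
  assumes f: "\<And>n. L2 M (f n)" "L2 M f'" "((\<lambda>n. sqn M (\<lambda>x. f n x - f' x)) \<longlongrightarrow> 0) F"
    and g: "\<And>n. L2 M (g n)" "L2 M g'" "((\<lambda>n. sqn M (\<lambda>x. g n x - g' x)) \<longlongrightarrow> 0) F"
  shows "((\<lambda>n. L2inner M (f n) (g n)) \<longlongrightarrow> L2inner M f' g') F"
proof -
  let ?b1 = "\<lambda>n. sqrt (sqn M (\<lambda>x. f n x - f' x) * (2 * sqn M (\<lambda>x. g n x - g' x) + 2 * sqn M g'))"
  let ?b2 = "\<lambda>n. sqrt (sqn M f' * sqn M (\<lambda>x. g n x - g' x))"
  have "norm (L2inner M (f n) (g n) - L2inner M f' g') \<le> ?b1 n + ?b2 n" for n
  proof -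
    have "sqn M (g n) \<le> 2 * sqn M (\<lambda>x. g n x - g' x) + 2 * sqn M g'"
      using sqn_add_le[OF L2_diff[OF g(1)[of n] g(2)] g(2)] by simp
    then have "(cmod (L2inner M (\<lambda>x. f n x - f' x) (g n)))^2
        \<le> sqn M (\<lambda>x. f n x - f' x) * (2 * sqn M (\<lambda>x. g n x - g' x) + 2 * sqn M g')"
      by (intro order_trans[OF L2_CS[OF L2_diff[OF f(1) f(2)] g(1)]] mult_left_mono) (simp_all add: sqn_nonneg)
    then have 1: "cmod (L2inner M (\<lambda>x. f n x - f' x) (g n)) \<le> ?b1 n"
      by (rule real_le_rsqrt)
    have 2: "cmod (L2inner M f' (\<lambda>x. g n x - g' x)) \<le> ?b2 n"
      by (rule real_le_rsqrt, rule L2_CS[OF f(2) L2_diff[OF g(1) g(2)]])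
    have "L2inner M (f n) (g n) - L2inner M f' g'
        = L2inner M (\<lambda>x. f n x - f' x) (g n) + L2inner M f' (\<lambda>x. g n x - g' x)"
      by (simp add: L2inner_diff_left L2inner_diff_right f g)
    then show ?thesis using 1 2 norm_triangle_mono by metis
  qed
  moreover have "((\<lambda>n. ?b1 n + ?b2 n) \<longlongrightarrow> sqrt (0 * (2 * 0 + 2 * sqn M g')) + sqrt (sqn M f' * 0)) F"
    by (intro tendsto_intros f g)
  ultimately have "((\<lambda>n. L2inner M (f n) (g n) - L2inner M f' g') \<longlongrightarrow> 0) F"
    by (intro Lim_null_comparison[OF always_eventually[of "\<lambda>n. norm (L2inner M (f n) (g n) - L2inner M f' g') \<le> ?b1 n + ?b2 n"]]) auto
  then show ?thesis by (simp add: LIM_zero_iff)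
qed

lemma tendsto_sqn:
  assumes f: "\<And>n. L2 M (f n)" "L2 M f'" "((\<lambda>n. sqn M (\<lambda>x. f n x - f' x)) \<longlongrightarrow> 0) F"
  shows "((\<lambda>n. sqn M (f n)) \<longlongrightarrow> sqn M f') F"
  using tendsto_Re[OF tendsto_L2inner[OF f f]] by (simp add: L2inner_self)

lemma polarization:
  fixes z w :: complex
  shows "4 * (z * cnj w) = of_real ((cmod (z + w))^2) - of_real ((cmod (z - w))^2)
     + \<i> * of_real ((cmod (z + \<i> * w))^2) - \<i> * of_real ((cmod (z - \<i> * w))^2)"
  by (simp only: complex_norm_square complex_cnj_add complex_cnj_diff complex_cnj_mult complex_cnj_i)
     (simp add: algebra_simps)

lemma L2inner_polarization:
  assumes f: "L2 M f" and g: "L2 M g"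
  shows "4 * L2inner M f g = of_real (sqn M (\<lambda>x. f x + g x)) - of_real (sqn M (\<lambda>x. f x - g x))
     + \<i> * of_real (sqn M (\<lambda>x. f x + \<i> * g x)) - \<i> * of_real (sqn M (\<lambda>x. f x - \<i> * g x))"
proof -
  have i: "integrable M (\<lambda>x. complex_of_real ((cmod (h x))^2))" if "L2 M h" for h
    using L2_integrable[OF that] by (rule integrable_of_real)
  note i' = i[OF L2_add[OF f g]] i[OF L2_diff[OF f g]] i[OF L2_add[OF f L2_scale[OF g, of \<i>]]]
    i[OF L2_diff[OF f L2_scale[OF g, of \<i>]]]
  have "4 * L2inner M f g = (LINT x|M. 4 * (f x * cnj (g x)))"
    unfolding L2inner_def by simp
  also have "\<dots> = of_real (sqn M (\<lambda>x. f x + g x)) - of_real (sqn M (\<lambda>x. f x - g x))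
     + \<i> * of_real (sqn M (\<lambda>x. f x + \<i> * g x)) - \<i> * of_real (sqn M (\<lambda>x. f x - \<i> * g x))"
    unfolding polarization sqn_def using i'
    by (simp del: of_real_power)
  finally show ?thesis .
qed

lemma sqn_diff_expand:
  assumes f: "L2 M f" and g: "L2 M g"
  shows "sqn M (\<lambda>x. f x - g x) = sqn M f - 2 * Re (L2inner M f g) + sqn M g"
proof -
  have "(cmod (z - w))^2 = (cmod z)^2 - 2 * Re (z * cnj w) + (cmod w)^2" for z w
    unfolding cmod_power2 by (simp add: power2_eq_square algebra_simps)
  then have "sqn M (\<lambda>x. f x - g x) = (LINT x|M. (cmod (f x))^2 - 2 * Re (f x * cnj (g x)) + (cmod (g x))^2)"
    by (simp add: sqn_def)
  also have "\<dots> = sqn M f - 2 * (LINT x|M. Re (f x * cnj (g x))) + sqn M g"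
    using f g L2inner_integrable[OF f g] unfolding sqn_def by (simp add: L2_def del: times_complex.sel)
  also have "(LINT x|M. Re (f x * cnj (g x))) = Re (L2inner M f g)"
    unfolding L2inner_def using L2inner_integrable[OF f g] by (rule integral_Re)
  finally show ?thesis .
qed

lemma sqn_eq_0D:
  assumes "L2 M f" "sqn M f = 0"
  shows "AE x in M. f x = 0"
  using assms integral_nonneg_eq_0_iff_AE[OF L2_integrable[OF assms(1)]]
  by (simp add: sqn_def)

section \<open>Completeness of L2\<close>

lemma summable_of_weighted_squares:
  fixes d :: "nat \<Rightarrow> complex"
  assumes "summable (\<lambda>j. 2^j * (cmod (d j))^2)"
  shows "summable (\<lambda>j. cmod (d j))"
proof (rule summable_comparison_test)
  show "summable (\<lambda>j. 2^j * (cmod (d j))^2 + (1/2)^j)"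
    by (intro summable_add assms) simp
  have "cmod (d j) \<le> 2^j * (cmod (d j))^2 + (1/2)^j" for j
  proof -
    let ?x = "cmod (d j)" and ?t = "sqrt (2^j)"
    have t: "?t^2 = 2^j" "?t > 0" by auto
    \<comment> \<open>Arithmetic-geometric mean inequality, balanced so that the remainder
      \<open>(1/2)^j\<close> is summable.\<close>
    have "0 \<le> (?t * ?x - 1 / ?t)^2" by simp
    also have "\<dots> = ?t^2 * ?x^2 - 2 * ?x + 1 / ?t^2"
      using t(2) by (simp add: power2_diff power_mult_distrib power_divide del: real_sqrt_power)
    also have "\<dots> = 2^j * ?x^2 - 2 * ?x + (1/2)^j"
      by (simp add: t power_divide)
    finally show ?thesis using norm_ge_zero[of "d j"] by linarith
  qed
  then show "\<exists>N. \<forall>n\<ge>N. norm (cmod (d n)) \<le> 2^n * (cmod (d n))^2 + (1/2)^n"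
    by auto
qed

text \<open>Fatou's lemma for the squared moduli. Asking for the bound only eventually lets it be a
  Cauchy estimate with the other index fixed.\<close>

lemma L2_Fatou:
  assumes f: "\<And>n. L2 M (f n)" and g: "g \<in> borel_measurable M"
    and lim: "AE x in M. (\<lambda>n. f n x) \<longlonglongrightarrow> g x"
    and le: "eventually (\<lambda>n. sqn M (f n) \<le> C) sequentially"
  shows "L2 M g" "sqn M g \<le> C"
proof -
  have [measurable]: "\<And>n. f n \<in> borel_measurable M" using f by (auto simp: L2_def)
  have C: "C \<ge> 0"
    using eventually_happens[OF le] order_trans[OF sqn_nonneg] by auto
  have "(\<integral>\<^sup>+x. ennreal ((cmod (g x))^2) \<partial>M) = (\<integral>\<^sup>+x. liminf (\<lambda>n. ennreal ((cmod (f n x))^2)) \<partial>M)"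
  proof (rule nn_integral_cong_AE, use lim in eventually_elim)
    case (elim x)
    have "(\<lambda>n. ennreal ((cmod (f n x))^2)) \<longlonglongrightarrow> ennreal ((cmod (g x))^2)"
      by (intro tendsto_intros elim)
    then show ?case by (intro lim_imp_Liminf[symmetric]) auto
  qed
  also have "\<dots> \<le> liminf (\<lambda>n. \<integral>\<^sup>+x. ennreal ((cmod (f n x))^2) \<partial>M)"
    by (rule nn_integral_liminf) simp
  also have "\<dots> = liminf (\<lambda>n. ennreal (sqn M (f n)))"
    by (simp add: nn_integral_cmod_sq f)
  also have "\<dots> \<le> ennreal C"
    by (rule Liminf_le[OF sequentially_bot], use le in eventually_elim) (auto intro: ennreal_leI)
  finally have *: "(\<integral>\<^sup>+x. ennreal ((cmod (g x))^2) \<partial>M) \<le> ennreal C" .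
  show L: "L2 M g"
    unfolding L2_def
  proof (intro conjI g integrableI_bounded)
    show "(\<lambda>x. (cmod (g x))\<^sup>2) \<in> borel_measurable M" using g by simp
    show "(\<integral>\<^sup>+ x. ennreal (norm ((cmod (g x))\<^sup>2)) \<partial>M) < \<infinity>"
      using * by (simp add: le_less_trans less_top)
  qed
  show "sqn M g \<le> C"
    using * nn_integral_cmod_sq[OF L] C by (simp add: ennreal_le_iff)
qed

text \<open>Riesz-Fischer: a subsequence with geometrically shrinking steps converges almost
  everywhere, and Fatou turns the Cauchy bound into norm convergence of the full sequence.\<close>

lemma L2_complete:
  assumes f: "\<And>n::nat. L2 M (f n)"
    and cauchy: "\<And>e. e > 0 \<Longrightarrow> \<exists>N. \<forall>m\<ge>N. \<forall>n\<ge>N. sqn M (\<lambda>x. f m x - f n x) \<le> e"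
  obtains g where "L2 M g" "(\<lambda>n. sqn M (\<lambda>x. f n x - g x)) \<longlonglongrightarrow> 0"
proof -
  have [measurable]: "\<And>n. f n \<in> borel_measurable M" using f by (auto simp: L2_def)
  obtain N where N: "\<And>j m n. m \<ge> N j \<Longrightarrow> n \<ge> N j \<Longrightarrow> sqn M (\<lambda>x. f m x - f n x) \<le> (1/4)^j"
    using cauchy[of "(1/4)^j" for j] by (metis zero_less_divide_1_iff zero_less_numeral zero_less_power)
  \<comment> \<open>Summing all \<open>N i\<close> makes \<open>r\<close> monotone and keeps
    \<open>r j\<close> above \<open>N j\<close>; the extra \<open>j\<close> drives \<open>r\<close>
    to infinity.\<close>
  define r where "r j = (\<Sum>i\<le>j. N i) + j" for j
  have rN: "r j \<ge> N j" for j
    unfolding r_def by (simp add: member_le_sum trans_le_add1)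
  have rS: "r j \<le> r (Suc j)" and rj: "r j \<ge> j" for j by (simp_all add: r_def)
  have rN': "r (Suc j) \<ge> N j" for j using rN rS order_trans by blast
  define d where "d j x = f (r (Suc j)) x - f (r j) x" for j x
  have [measurable]: "\<And>j. d j \<in> borel_measurable M" unfolding d_def by simp
  have Ld: "L2 M (d j)" for j unfolding d_def by (intro L2_diff f)
  have dle: "sqn M (d j) \<le> (1/4)^j" for j
    unfolding d_def by (rule N[OF rN' rN])
  \<comment> \<open>The weight \<open>2^j\<close> spends part of the decay \<open>(1/4)^j\<close>:
    the integrals still sum like \<open>(1/2)^j\<close>, and a finite weighted sum of squares forces
    absolute summability of \<open>d j x\<close>.\<close>
  have "(\<integral>\<^sup>+x. (\<Sum>j. ennreal (2^j * (cmod (d j x))^2)) \<partial>M) = (\<Sum>j. \<integral>\<^sup>+x. ennreal (2^j * (cmod (d j x))^2) \<partial>M)"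
    by (rule nn_integral_suminf) simp
  also have "\<dots> = (\<Sum>j. ennreal (2^j * sqn M (d j)))"
    using nn_integral_cmod_sq[OF Ld] by (simp add: ennreal_mult' nn_integral_cmult)
  also have "\<dots> \<le> (\<Sum>j. ennreal ((1/2)^j))"
  proof (intro suminf_le ennreal_leI)
    fix j
    have "2^j * sqn M (d j) \<le> 2^j * (1/4)^j" using dle by simp
    also have "\<dots> = (1/2)^j" by (simp add: power_mult_distrib[symmetric])
    finally show "2^j * sqn M (d j) \<le> (1/2)^j" .
  qed auto
  also have "\<dots> = ennreal (\<Sum>j. (1/2)^j)"
    by (rule suminf_ennreal2) auto
  also have "\<dots> < \<infinity>" by simp
  finally have "(\<integral>\<^sup>+x. (\<Sum>j. ennreal (2^j * (cmod (d j x))^2)) \<partial>M) \<noteq> \<infinity>" by simp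
  then have "AE x in M. (\<Sum>j. ennreal (2^j * (cmod (d j x))^2)) \<noteq> \<infinity>"
    by (intro nn_integral_PInf_AE) auto
  then have conv: "AE x in M. convergent (\<lambda>j. f (r j) x)"
  proof eventually_elim
    case (elim x)
    have "summable (\<lambda>j. 2^j * (cmod (d j x))^2)"
      by (rule summable_suminf_not_top) (use elim in auto)
    then have "summable (\<lambda>j. d j x)"
      by (rule summable_norm_cancel[OF summable_of_weighted_squares])
    then have "convergent (\<lambda>n. (\<Sum>j<n. d j x))"
      by (simp add: summable_iff_convergent)
    moreover have "(\<Sum>j<n. d j x) = f (r n) x - f (r 0) x" for n
      unfolding d_def by (rule sum_lessThan_telescope)
    ultimately have "convergent (\<lambda>n. f (r n) x - f (r 0) x)" by simp
    then show ?case
      by (simp add: convergent_diff_const_right_iff)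
  qed
  define g where "g x = lim (\<lambda>j. f (r j) x)" for x
  have g[measurable]: "g \<in> borel_measurable M"
    unfolding g_def by (rule borel_measurable_lim_metric) simp
  have lim: "AE x in M. (\<lambda>j. f (r j) x) \<longlonglongrightarrow> g x"
    using conv by eventually_elim (simp add: g_def convergent_LIMSEQ_iff)
  have bd: "L2 M (\<lambda>x. f n x - g x) \<and> sqn M (\<lambda>x. f n x - g x) \<le> e"
    if "\<forall>m\<ge>K. \<forall>n\<ge>K. sqn M (\<lambda>x. f m x - f n x) \<le> e" "n \<ge> K" for n e K
  proof -
    have 1: "\<And>j. L2 M (\<lambda>x. f n x - f (r j) x)" by (intro L2_diff f)
    have 2: "(\<lambda>x. f n x - g x) \<in> borel_measurable M" by simp
    have 3: "AE x in M. (\<lambda>j. f n x - f (r j) x) \<longlonglongrightarrow> f n x - g x"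
      using lim by eventually_elim (intro tendsto_intros)
    have 4: "eventually (\<lambda>j. sqn M (\<lambda>x. f n x - f (r j) x) \<le> e) sequentially"
      using eventually_ge_at_top[of K] by eventually_elim (use that rj order_trans in blast)
    show ?thesis using L2_Fatou[OF 1 2 3 4] by simp
  qed
  obtain K where K: "\<forall>m\<ge>K. \<forall>n\<ge>K. sqn M (\<lambda>x. f m x - f n x) \<le> 1"
    using cauchy[of 1] by auto
  have "L2 M (\<lambda>x. f K x - (f K x - g x))"
    by (intro L2_diff f conjunct1[OF bd[OF K]]) simp
  then have "L2 M g" by simp
  moreover have "(\<lambda>n. sqn M (\<lambda>x. f n x - g x)) \<longlonglongrightarrow> 0"
  proof (rule LIMSEQ_I)
    fix e :: real assume "e > 0"
    then obtain K where "\<forall>m\<ge>K. \<forall>n\<ge>K. sqn M (\<lambda>x. f m x - f n x) \<le> e / 2"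
      using cauchy[of "e/2"] by auto
    note b = bd[OF this]
    show "\<exists>no. \<forall>n\<ge>no. norm (sqn M (\<lambda>x. f n x - g x) - 0) < e"
    proof (intro exI[of _ K] allI impI)
      fix n assume "n \<ge> K"
      then have "sqn M (\<lambda>x. f n x - g x) \<le> e / 2" using b by blast
      then show "norm (sqn M (\<lambda>x. f n x - g x) - 0) < e"
        using \<open>e > 0\<close> by (simp add: sqn_nonneg)
    qed
  qed
  ultimately show ?thesis by (rule that)
qed

section \<open>The Fourier transform and Plancherel's identity\<close>

text \<open>Meaningful for integrable \<open>g\<close> only, as the Bochner integral otherwise
  defaults to 0. Writing the phase with \<open>cis\<close> keeps its modulus 1 visible.\<close>

definition FT :: "(real \<Rightarrow> complex) \<Rightarrow> real \<Rightarrow> complex" where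
  "FT g \<xi> = (LINT x|lborel. g x * cis (- 2 * pi * x * \<xi>))"

lemma measurable_cis[measurable]: "f \<in> borel_measurable M \<Longrightarrow> (\<lambda>x. cis (f x)) \<in> borel_measurable M"
  by (rule measurable_compose[OF _ borel_measurable_continuous_onI]) (auto intro!: continuous_intros)

lemma measurable_cnj[measurable]: "f \<in> borel_measurable M \<Longrightarrow> (\<lambda>x. cnj (f x)) \<in> borel_measurable M"
  by (rule measurable_compose[OF _ borel_measurable_continuous_onI]) (auto intro!: continuous_intros)

lemma FT_measurable[measurable]:
  assumes [measurable]: "g \<in> borel_measurable lborel"
  shows "FT g \<in> borel_measurable lborel"
  unfolding FT_def by measurable

lemma integrable_mult_unimodular:
  fixes g :: "'a \<Rightarrow> complex"
  assumes "integrable M g" "b \<in> borel_measurable M" "\<And>x. cmod (b x) \<le> 1"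
  shows "integrable M (\<lambda>x. g x * b x)"
  by (rule Bochner_Integration.integrable_bound[OF assms(1)])
     (use assms in \<open>auto simp: norm_mult intro!: mult_right_le_one_le\<close>)

lemma FT_integrable:
  "integrable lborel g \<Longrightarrow> integrable lborel (\<lambda>x. g x * cis (a * x * b))"
  by (rule integrable_mult_unimodular) auto

lemma norm_FT_le:
  shows "cmod (FT g \<xi>) \<le> (LINT x|lborel. cmod (g x))"
  unfolding FT_def using integral_norm_bound[of lborel "\<lambda>x. g x * cis (- 2 * pi * x * \<xi>)"]
  by (simp add: norm_mult)

lemma FT_diff:
  assumes "integrable lborel f" "integrable lborel g"
  shows "FT (\<lambda>x. f x - g x) \<xi> = FT f \<xi> - FT g \<xi>"
  unfolding FT_def left_diff_distrib
  by (rule Bochner_Integration.integral_diff[OF FT_integrable[OF assms(1)] FT_integrable[OF assms(2)]])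

lemma FT_add:
  assumes "integrable lborel f" "integrable lborel g"
  shows "FT (\<lambda>x. f x + g x) \<xi> = FT f \<xi> + FT g \<xi>"
  unfolding FT_def distrib_right
  by (rule Bochner_Integration.integral_add[OF FT_integrable[OF assms(1)] FT_integrable[OF assms(2)]])

lemma FT_scale: "FT (\<lambda>x. c * f x) \<xi> = c * FT f \<xi>"
  unfolding FT_def by (simp add: mult.assoc)

lemma lborel_integral_shift:
  fixes f :: "real \<Rightarrow> 'a :: {banach, second_countable_topology}"
  shows "(LINT x|lborel. f (x + t)) = (LINT x|lborel. f x)"
  using lborel_integral_real_affine[of 1 f t] by (simp add: add.commute)

lemma lborel_integrable_shift:
  fixes f :: "real \<Rightarrow> 'a :: {banach, second_countable_topology}"
  shows "integrable lborel f \<Longrightarrow> integrable lborel (\<lambda>x. f (x + t))"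
  using lborel_integrable_real_affine[of f 1 t] by (simp add: add.commute)

lemma integrable_pair_mult:
  fixes f h :: "real \<Rightarrow> complex"
  assumes f: "integrable lborel f" and h: "integrable lborel h"
    and b: "b \<in> borel_measurable (lborel \<Otimes>\<^sub>M lborel)" "\<And>p. cmod (b p) \<le> 1"
  shows "integrable (lborel \<Otimes>\<^sub>M lborel) (\<lambda>(x, y). f x * h y * b (x, y))"
proof -
  have [measurable]: "f \<in> borel_measurable lborel" "h \<in> borel_measurable lborel"
    using f h by auto
  have "integrable (lborel \<Otimes>\<^sub>M lborel) (\<lambda>(x, y). f x * h y)"
    by (rule lborel_pair.Fubini_integrable) (use f h in \<open>auto simp: norm_mult\<close>)
  from integrable_mult_unimodular[OF this b] show ?thesis by (simp add: case_prod_beta')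
qed

text \<open>Fubini for the product of \<open>f\<close>, \<open>h\<close> and a phase of modulus 1.
  It serves twice: with a Gaussian as \<open>h\<close>, and as the adjoint relation in the
  construction of inverse transforms.\<close>

lemma multiplication_formula:
  assumes f: "integrable lborel f" and h: "integrable lborel h"
  shows "(LINT \<xi>|lborel. FT f \<xi> * h \<xi>) = (LINT x|lborel. f x * FT h x)"
proof -
  have "integrable (lborel \<Otimes>\<^sub>M lborel) (\<lambda>(x, y). f x * h y * (\<lambda>(x,y). cis (- 2 * pi * x * y)) (x, y))"
    by (rule integrable_pair_mult[OF f h]) auto
  then have i: "integrable (lborel \<Otimes>\<^sub>M lborel) (\<lambda>(x, y). f x * h y * cis (- 2 * pi * x * y))"
    by simp
  have "(LINT \<xi>|lborel. FT f \<xi> * h \<xi>) = (LINT \<xi>|lborel. LINT x|lborel. f x * h \<xi> * cis (- 2 * pi * x * \<xi>))"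
    unfolding FT_def by (simp add: ac_simps flip: integral_mult_right_zero integral_mult_left_zero)
  also have "\<dots> = (LINT x|lborel. LINT \<xi>|lborel. f x * h \<xi> * cis (- 2 * pi * x * \<xi>))"
    by (rule lborel_pair.Fubini_integral[OF i])
  also have "\<dots> = (LINT x|lborel. f x * FT h x)"
    unfolding FT_def by (simp add: ac_simps flip: integral_mult_right_zero)
  finally show ?thesis .
qed

section \<open>Autocorrelation and its Fourier transform\<close>

definition autocorr :: "(real \<Rightarrow> complex) \<Rightarrow> real \<Rightarrow> complex" where
  "autocorr g t = (LINT y|lborel. cnj (g y) * g (t + y))"

text \<open>By translation invariance, the modulus integrates in \<open>t\<close> to
  \<open>cmod (g y)\<close> times the L1 norm of \<open>g\<close>.\<close>

lemma autocorr_integrable_pair: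
  fixes g :: "real \<Rightarrow> complex"
  assumes g: "integrable lborel g"
  shows "integrable (lborel \<Otimes>\<^sub>M lborel) (\<lambda>(y, t). cnj (g y) * g (t + y))"
proof -
  have [measurable]: "g \<in> borel_measurable lborel"
    using g by auto
  show ?thesis
  proof (rule lborel_pair.Fubini_integrable)
    have "(LINT t|lborel. cmod (g (t + y))) = (LINT t|lborel. cmod (g t))" for y :: real
      by (rule lborel_integral_shift[of "\<lambda>x. cmod (g x)"])
    then show "integrable lborel (\<lambda>x. LINT y|lborel. norm (case (x, y) of (y, t) \<Rightarrow> cnj (g y) * g (t + y)))"
      using g by (simp add: norm_mult)
    show "AE x in lborel. integrable lborel (\<lambda>y. case (x, y) of (y, t) \<Rightarrow> cnj (g y) * g (t + y))"
      using lborel_integrable_shift[OF g] by auto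
  qed simp
qed

lemma autocorr_integrable:
  assumes g: "integrable lborel g"
  shows "integrable lborel (autocorr g)"
  using lborel_pair.integrable_snd[OF autocorr_integrable_pair[OF g]]
  unfolding autocorr_def .

text \<open>The convolution theorem for \<open>g\<close> and its reflected conjugate: shifting by
  \<open>y\<close> releases a phase in \<open>y\<close> that assembles the conjugate of
  \<open>FT g\<close>.\<close>

lemma FT_autocorr:
  assumes g: "integrable lborel g"
  shows "FT (autocorr g) \<xi> = of_real ((cmod (FT g \<xi>))^2)"
proof -
  have [measurable]: "g \<in> borel_measurable lborel"
    using g by auto
  have i: "integrable (lborel \<Otimes>\<^sub>M lborel) (\<lambda>(y, t). cnj (g y) * g (t + y) * cis (- 2 * pi * t * \<xi>))"
    using integrable_mult_unimodular[OF autocorr_integrable_pair[OF g], of "\<lambda>(y, t). cis (- 2 * pi * t * \<xi>)"]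
    by (simp add: case_prod_beta')
  have inner: "(LINT t|lborel. g (t + y) * cis (- 2 * pi * t * \<xi>)) = cis (2 * pi * y * \<xi>) * FT g \<xi>" for y
  proof -
    have "(LINT t|lborel. g (t + y) * cis (- 2 * pi * t * \<xi>))
        = (LINT t|lborel. cis (2 * pi * y * \<xi>) * (g (t + y) * cis (- 2 * pi * (t + y) * \<xi>)))"
      by (intro Bochner_Integration.integral_cong) (auto simp: cis_mult algebra_simps)
    also have "\<dots> = cis (2 * pi * y * \<xi>) * (LINT t|lborel. g (t + y) * cis (- 2 * pi * (t + y) * \<xi>))"
      by (rule integral_mult_right_zero)
    also have "(LINT t|lborel. g (t + y) * cis (- 2 * pi * (t + y) * \<xi>)) = FT g \<xi>"
      unfolding FT_def by (rule lborel_integral_shift)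
    finally show ?thesis .
  qed
  have "FT (autocorr g) \<xi> = (LINT t|lborel. LINT y|lborel. cnj (g y) * g (t + y) * cis (- 2 * pi * t * \<xi>))"
    unfolding FT_def autocorr_def by (simp flip: integral_mult_left_zero)
  also have "\<dots> = (LINT y|lborel. LINT t|lborel. cnj (g y) * g (t + y) * cis (- 2 * pi * t * \<xi>))"
    by (rule lborel_pair.Fubini_integral[OF i])
  also have "\<dots> = (LINT y|lborel. cnj (g y) * (LINT t|lborel. g (t + y) * cis (- 2 * pi * t * \<xi>)))"
    by (simp add: mult.assoc flip: integral_mult_right_zero)
  also have "\<dots> = (LINT y|lborel. cnj (g y * cis (- 2 * pi * y * \<xi>)) * FT g \<xi>)"
    unfolding inner by (simp add: cis_cnj mult.assoc)
  also have "\<dots> = cnj (FT g \<xi>) * FT g \<xi>"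
    unfolding FT_def integral_mult_left_zero Bochner_Integration.integral_cnj ..
  also have "\<dots> = of_real ((cmod (FT g \<xi>))^2)"
    by (simp only: complex_norm_square mult.commute)
  finally show ?thesis .
qed

section \<open>Gaussian weights and their transforms\<close>

definition gaussw :: "real \<Rightarrow> real \<Rightarrow> real" where
  "gaussw n \<xi> = exp (- ((\<xi> / n)^2) / 2)"

text \<open>This is the characteristic function of the standard normal distribution, cleared of the
  factor \<open>1 / sqrt (2 * pi)\<close>.\<close>

lemma gaussian_integral_cis:
  "(LINT s|lborel. complex_of_real (exp (- (s^2) / 2)) * cis (t * s)) = of_real (sqrt (2 * pi) * exp (- (t^2) / 2))"
proof -
  have "complex_of_real (exp (- (t^2) / 2)) = char std_normal_distribution t"
    by (simp add: char_std_normal_distribution)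
  also have "\<dots> = (LINT s|lborel. std_normal_density s *\<^sub>R iexp (t * s))"
    unfolding char_def by (subst integral_density) auto
  also have "\<dots> = (LINT s|lborel. of_real (1 / sqrt (2 * pi)) * (of_real (exp (- (s^2) / 2)) * cis (t * s)))"
    by (intro Bochner_Integration.integral_cong) (simp_all add: std_normal_density_def cis_conv_exp scaleR_conv_of_real)
  also have "\<dots> = of_real (1 / sqrt (2 * pi)) * (LINT s|lborel. of_real (exp (- (s^2) / 2)) * cis (t * s))"
    by (rule integral_mult_right_zero)
  finally show ?thesis
    by (simp add: field_simps)
qed

lemma gaussw_measurable[measurable]: "gaussw n \<in> borel_measurable borel"
  unfolding gaussw_def[abs_def] by measurable

lemma gaussw_integrable:
  assumes n: "n > 0"
  shows "integrable lborel (gaussw n)"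
proof -
  have "integrable lborel (\<lambda>x. sqrt (2 * pi) * std_normal_density x)"
    by (intro integrable_mult_right) auto
  then have "integrable lborel (\<lambda>x::real. exp (- (x^2) / 2))"
    by (simp add: std_normal_density_def)
  from lborel_integrable_real_affine[OF this, of "1/n" 0] n show ?thesis
    by (simp add: gaussw_def[abs_def])
qed

lemma FT_gaussw:
  assumes n: "n > 0"
  shows "FT (\<lambda>\<xi>. of_real (gaussw n \<xi>)) t = of_real (n * sqrt (2 * pi) * exp (- ((2 * pi * n * t)^2) / 2))"
proof -
  have "FT (\<lambda>\<xi>. of_real (gaussw n \<xi>)) t
    = n *\<^sub>R (LINT s|lborel. complex_of_real (exp (- (s^2) / 2)) * cis ((- 2 * pi * n * t) * s))"
    unfolding FT_def using n
    by (subst lborel_integral_real_affine[of n _ 0]) (simp_all add: gaussw_def ac_simps)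
  then show ?thesis
    unfolding gaussian_integral_cis by (simp add: scaleR_conv_of_real)
qed

section \<open>Plancherel for bounded functions of bounded support\<close>

definition bounded_support :: "real \<Rightarrow> real \<Rightarrow> (real \<Rightarrow> complex) \<Rightarrow> bool" where
  "bounded_support B R g \<longleftrightarrow> g \<in> borel_measurable lborel \<and>
     (\<forall>x. cmod (g x) \<le> B) \<and> (\<forall>x. \<bar>x\<bar> > R \<longrightarrow> g x = 0)"

lemma bounded_supportI:
  assumes "g \<in> borel_measurable lborel" "\<And>x. cmod (g x) \<le> B" "\<And>x. \<bar>x\<bar> > R \<Longrightarrow> g x = 0"
  shows "bounded_support B R g"
  using assms by (simp add: bounded_support_def)

lemma bounded_supportD:
  assumes "bounded_support B R g"
  shows "g \<in> borel_measurable lborel" "\<And>x. cmod (g x) \<le> B" "\<And>x. \<bar>x\<bar> > R \<Longrightarrow> g x = 0"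
  using assms by (auto simp: bounded_support_def)


lemma bounded_support_integrable:
  assumes G: "bounded_support B R g"
  shows "integrable lborel g"
proof (rule Bochner_Integration.integrable_bound)
  note g = bounded_supportD[OF G]
  show "integrable lborel (\<lambda>x. B * indicator {-R..R} x)"
    by (intro integrable_mult_right integrable_real_indicator) (auto simp: emeasure_lborel_Icc_eq)
  have "0 \<le> B" using g(2)[of 0] norm_ge_zero order_trans by blast
  show "AE x in lborel. norm (g x) \<le> norm (B * indicator {- R..R} x)"
  proof (rule AE_I2)
    fix x
    show "norm (g x) \<le> norm (B * indicator {- R..R} x)"
      using g(2)[of x] g(3)[of x] \<open>0 \<le> B\<close>
      by (cases "\<bar>x\<bar> > R") (auto simp: indicator_def abs_le_iff)
  qed
  show "g \<in> borel_measurable lborel" by (rule g)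
qed

lemma bounded_support_L2:
  assumes G: "bounded_support B R g"
  shows "L2 lborel g"
proof -
  note g = bounded_supportD[OF G]
  have [measurable]: "g \<in> borel_measurable lborel" by (rule g)
  have "cmod (g x * cnj (g x)) \<le> B * B" for x
    using g(2)[of x] by (auto simp: norm_mult intro!: mult_mono order_trans[OF norm_ge_zero])
  then have "bounded_support (B * B) R (\<lambda>x. g x * cnj (g x))"
    using g(3) by (intro bounded_supportI) auto
  then have "integrable lborel (\<lambda>x. g x * cnj (g x))"
    by (rule bounded_support_integrable)
  then have "integrable lborel (\<lambda>x. complex_of_real ((cmod (g x))^2))"
    by (simp only: complex_norm_square)
  from integrable_Re[OF this] show ?thesis using g(1) by (simp add: L2_def)
qed

text \<open>A measurable function is an almost everywhere limit of continuous ones. Composing these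
  with a continuous retraction onto a disc and multiplying by a continuous bump restores bound and
  support without disturbing the limit.\<close>

lemma continuous_approximants:
  fixes g :: "real \<Rightarrow> complex"
  assumes G: "bounded_support B R g"
  obtains h where "\<And>n::nat. continuous_on UNIV (h n)" "\<And>n x. cmod (h n x) \<le> B"
    "\<And>n x. \<bar>x\<bar> > R + 1 \<Longrightarrow> h n x = 0" "AE x in lborel. (\<lambda>n. h n x) \<longlonglongrightarrow> g x"
proof -
  note g = bounded_supportD[OF G]
  have B: "0 \<le> B" using g(2)[of 0] norm_ge_zero order_trans by blast
  have "g measurable_on UNIV"
    by (rule lebesgue_measurable_imp_measurable_on) (use g(1) in \<open>auto intro: measurable_completion\<close>)
  then obtain N k where N: "negligible N" and k: "\<And>n. continuous_on UNIV (k n)"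
    "\<And>x. x \<notin> N \<Longrightarrow> (\<lambda>n. k n x) \<longlonglongrightarrow> g x"
    unfolding measurable_on_def by auto
  \<comment> \<open>\<open>p\<close> is the radial retraction onto the disc of radius
    \<open>B\<close>; \<open>c\<close> below is 1 where \<open>\<bar>x\<bar> \<le> R\<close>, 0
    beyond \<open>R + 1\<close>, and continuous.\<close>
  define p where "p z = z * of_real (B / max B (cmod z))" for z :: complex
  define c where "c x = max 0 (min 1 (R + 1 - \<bar>x\<bar>))" for x
  define h where "h n x = p (k n x) * of_real (c x)" for n x
  have pB: "cmod (p z) \<le> B" for z
  proof -
    have "cmod (p z) = cmod z * (B / max B (cmod z))"
      using B by (simp add: p_def norm_mult norm_divide)
    also have "\<dots> = B * (cmod z / max B (cmod z))" by simp
    also have "\<dots> \<le> B * 1" using B by (intro mult_left_mono) (auto simp: divide_le_eq_1)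
    finally show ?thesis by simp
  qed
  \<comment> \<open>The denominator in \<open>p\<close> is positive everywhere only for positive
    \<open>B\<close>; for \<open>B = 0\<close> the function \<open>g\<close> is itself 0.\<close>
  show ?thesis
  proof (cases "B = 0")
    case True
    then show ?thesis using g(2) by (intro that[of "\<lambda>_ _. 0"]) auto
  next
    case False
    with B have B': "B > 0" by simp
    have pc: "continuous_on UNIV p"
      unfolding p_def using B' by (intro continuous_intros) (auto simp: max_def)
    have pid: "p z = z" if "cmod z \<le> B" for z
      using that B' by (simp add: p_def max_def)
    show ?thesis
    proof (rule that)
      fix n
      show "continuous_on UNIV (h n)"
        unfolding h_def c_def
        by (intro continuous_intros continuous_on_compose2[OF pc k(1)]) auto
      fix x
      have "cmod (h n x) = cmod (p (k n x)) * \<bar>c x\<bar>" by (simp add: h_def norm_mult)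
      also have "\<dots> \<le> B * 1" using pB B by (intro mult_mono) (auto simp: c_def)
      finally show "cmod (h n x) \<le> B" by simp
      show "\<bar>x\<bar> > R + 1 \<Longrightarrow> h n x = 0" by (simp add: h_def c_def)
    next
      have "(\<lambda>n. h n x) \<longlonglongrightarrow> g x" if "x \<notin> N" for x
      proof -
        have "isCont p (g x)" using pc by (simp add: continuous_on_eq_continuous_at)
        from isCont_tendsto_compose[OF this k(2)[OF that]]
        have "(\<lambda>n. h n x) \<longlonglongrightarrow> p (g x) * of_real (c x)"
          unfolding h_def by (intro tendsto_intros)
        moreover have "p (g x) * of_real (c x) = g x"
          using g(3)[of x] pid[OF g(2)[of x]] by (cases "\<bar>x\<bar> > R") (auto simp: c_def)
        ultimately show ?thesis by simp
      qed
      moreover have "AE x in lborel. x \<notin> N"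
        using N by (metis AE_completion_iff AE_not_in negligible_iff_null_sets)
      ultimately show "AE x in lborel. (\<lambda>n. h n x) \<longlonglongrightarrow> g x" by auto
    qed
  qed
qed

text \<open>A three-term estimate: \<open>g\<close> is close in L1 to some \<open>h n\<close>,
  before and after translation alike, and for the continuous \<open>h n\<close> dominated
  convergence applies. The bound \<open>K\<close> keeps all translates inside one bounded
  interval.\<close>

lemma L1_translation_continuous:
  fixes g :: "real \<Rightarrow> complex"
  assumes G: "bounded_support B R g"
    and t: "t \<longlonglongrightarrow> 0" "\<And>m::nat. \<bar>t m\<bar> \<le> K"
  shows "(\<lambda>m. LINT y|lborel. cmod (g (y + t m) - g y)) \<longlonglongrightarrow> 0"
proof -
  note g = bounded_supportD[OF G]
  obtain h where h: "\<And>n::nat. continuous_on UNIV (h n)" "\<And>n x. cmod (h n x) \<le> B"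
    "\<And>n x. \<bar>x\<bar> > R + 1 \<Longrightarrow> h n x = 0" "AE x in lborel. (\<lambda>n. h n x) \<longlonglongrightarrow> g x"
    using continuous_approximants[OF G] by blast
  have hm[measurable]: "\<And>n. h n \<in> borel_measurable lborel"
    using borel_measurable_continuous_onI[OF h(1)] by simp
  have gm[measurable]: "g \<in> borel_measurable lborel" by (rule g)
  have gi: "integrable lborel g" by (rule bounded_support_integrable[OF G])
  have hi: "integrable lborel (h n)" for n by (rule bounded_support_integrable[OF bounded_supportI[OF hm h(2,3)]])
  have B: "0 \<le> B" using g(2)[of 0] norm_ge_zero order_trans by blast
  have dom: "integrable lborel (\<lambda>x. 2 * B * indicator {-S..S} x)" for S :: real
    by (intro integrable_mult_right integrable_real_indicator) (auto simp: emeasure_lborel_Icc_eq)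
  have "(\<lambda>n. LINT y|lborel. cmod (h n y - g y)) \<longlonglongrightarrow> (LINT y::real|lborel. 0)"
  proof (rule integral_dominated_convergence[where w="\<lambda>x. 2 * B * indicator {-(R+1)..R+1} x"])
    show "AE x in lborel. (\<lambda>n. cmod (h n x - g x)) \<longlonglongrightarrow> 0"
      using h(4) by eventually_elim (metis LIM_zero tendsto_norm_zero)
    show "AE x in lborel. norm (cmod (h n x - g x)) \<le> 2 * B * indicator {- (R + 1)..R + 1} x" for n
    proof (rule AE_I2)
      fix x
      have "cmod (h n x - g x) \<le> B + B"
        using norm_triangle_ineq4[of "h n x" "g x"] h(2)[of n x] g(2)[of x] by linarith
      then show "norm (cmod (h n x - g x)) \<le> 2 * B * indicator {- (R + 1)..R + 1} x"
        using h(3)[of x n] g(3)[of x] by (cases "\<bar>x\<bar> > R + 1") (auto simp: indicator_def abs_le_iff)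
    qed
  qed (use dom[of "R + 1"] in auto)
  then have l1: "(\<lambda>n. LINT y|lborel. cmod (h n y - g y)) \<longlonglongrightarrow> 0" by simp
  have l2: "(\<lambda>m. LINT y|lborel. cmod (h n (y + t m) - h n y)) \<longlonglongrightarrow> 0" for n
  proof -
    have "(\<lambda>m. LINT y|lborel. cmod (h n (y + t m) - h n y)) \<longlonglongrightarrow> (LINT y::real|lborel. 0)"
    proof (rule integral_dominated_convergence[where w="\<lambda>x. 2 * B * indicator {-(R+1+K)..R+1+K} x"])
      have "(\<lambda>m. cmod (h n (x + t m) - h n x)) \<longlonglongrightarrow> 0" for x
      proof -
        have "isCont (h n) (x + 0)" using h(1)[of n] by (simp add: continuous_on_eq_continuous_at)
        moreover have "(\<lambda>m. x + t m) \<longlonglongrightarrow> x + 0" by (intro tendsto_intros t)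
        ultimately have "(\<lambda>m. h n (x + t m)) \<longlonglongrightarrow> h n (x + 0)" by (rule isCont_tendsto_compose)
        then show ?thesis by (simp add: LIM_zero tendsto_norm_zero)
      qed
      then show "AE x in lborel. (\<lambda>m. cmod (h n (x + t m) - h n x)) \<longlonglongrightarrow> 0" by simp
      show "AE x in lborel. norm (cmod (h n (x + t m) - h n x)) \<le> 2 * B * indicator {-(R+1+K)..R+1+K} x" for m
      proof (rule AE_I2)
        fix x
        have "cmod (h n (x + t m) - h n x) \<le> B + B"
          using norm_triangle_ineq4[of "h n (x + t m)" "h n x"] h(2)[of n x] h(2)[of n "x + t m"] by linarith
        then show "norm (cmod (h n (x + t m) - h n x)) \<le> 2 * B * indicator {-(R+1+K)..R+1+K} x"
          using h(3)[of x n] h(3)[of "x + t m" n] t(2)[of m]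
          by (cases "\<bar>x\<bar> > R + 1 + K") (auto simp: indicator_def abs_le_iff)
      qed
    qed (use dom[of "R + 1 + K"] in auto)
    then show ?thesis by simp
  qed
  show ?thesis
  proof (rule LIMSEQ_I)
    fix e :: real assume "e > 0"
    then have "e / 3 > 0" by simp
    from LIMSEQ_D[OF l1 this] obtain n where n: "(LINT y|lborel. cmod (h n y - g y)) < e / 3"
      by fastforce
    from LIMSEQ_D[OF l2 \<open>e / 3 > 0\<close>] obtain M where
      M: "\<And>m. m \<ge> M \<Longrightarrow> (LINT y|lborel. cmod (h n (y + t m) - h n y)) < e / 3"
      by fastforce
    have "(LINT y|lborel. cmod (g (y + t m) - g y)) < e" if "m \<ge> M" for m
    proof -
      have i1: "integrable lborel (\<lambda>y. cmod (h n (y + s) - g (y + s)))" for s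
        using lborel_integrable_shift[OF hi] lborel_integrable_shift[OF gi] by auto
      have i2: "integrable lborel (\<lambda>y. cmod (h n (y + t m) - h n y))"
        using lborel_integrable_shift[OF hi] hi by auto
      have "(LINT y|lborel. cmod (g (y + t m) - g y)) \<le>
         (LINT y|lborel. cmod (h n (y + t m) - g (y + t m)) + cmod (h n (y + t m) - h n y) + cmod (h n (y + 0) - g (y + 0)))"
      proof (rule integral_mono)
        show "integrable lborel (\<lambda>y. cmod (g (y + t m) - g y))"
          using lborel_integrable_shift[OF gi] gi by auto
        show "integrable lborel (\<lambda>y. cmod (h n (y + t m) - g (y + t m)) + cmod (h n (y + t m) - h n y) + cmod (h n (y + 0) - g (y + 0)))"
          by (intro Bochner_Integration.integrable_add i1 i2)
        fix y
        have "g (y + t m) - g y = - (h n (y + t m) - g (y + t m)) + (h n (y + t m) - h n y) + (h n (y + 0) - g (y + 0))" by simp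
        also have "cmod \<dots> \<le> cmod (h n (y + t m) - g (y + t m)) + cmod (h n (y + t m) - h n y) + cmod (h n (y + 0) - g (y + 0))"
          by (intro norm_triangle_mono) (auto simp: norm_minus_commute)
        finally show "cmod (g (y + t m) - g y) \<le> cmod (h n (y + t m) - g (y + t m)) + cmod (h n (y + t m) - h n y) + cmod (h n (y + 0) - g (y + 0))" .
      qed
      also have "\<dots> = (LINT y|lborel. cmod (h n y - g y)) + (LINT y|lborel. cmod (h n (y + t m) - h n y)) + (LINT y|lborel. cmod (h n y - g y))"
        using i1[of "t m"] i1[of 0] i2 lborel_integral_shift[of "\<lambda>y. cmod (h n y - g y)" "t m"] by simp
      also have "\<dots> < e" using n M[OF that] by linarith
      finally show ?thesis .
    qed
    then show "\<exists>no. \<forall>m\<ge>no. norm ((LINT y|lborel. cmod (g (y + t m) - g y)) - 0) < e" by auto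
  qed
qed


text \<open>Uniform in \<open>t\<close>: this provides the dominating function when Gaussian
  averages of the autocorrelation pass to the limit.\<close>

lemma norm_autocorr_le:
  assumes g: "integrable lborel g" "\<And>x. cmod (g x) \<le> B"
  shows "cmod (autocorr g t) \<le> B * (LINT x|lborel. cmod (g x))"
proof -
  have B: "0 \<le> B" using g(2)[of 0] norm_ge_zero order_trans by blast
  have gm[measurable]: "g \<in> borel_measurable lborel" using g by auto
  have i1: "integrable lborel (\<lambda>x. cmod (g x) * B)" using g(1) by auto
  have "cmod (autocorr g t) \<le> (LINT y|lborel. cmod (g y) * cmod (g (t + y)))"
    unfolding autocorr_def using integral_norm_bound[of lborel "\<lambda>y. cnj (g y) * g (t + y)"]
    by (simp add: norm_mult)
  also have "\<dots> \<le> (LINT y|lborel. cmod (g y) * B)"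
  proof (rule integral_mono)
    show "integrable lborel (\<lambda>y. cmod (g y) * cmod (g (t + y)))"
      by (rule Bochner_Integration.integrable_bound[OF i1])
        (auto simp: abs_mult B intro!: mult_left_mono g)
  qed (auto intro!: i1 mult_left_mono g)
  finally show ?thesis by (simp add: mult.commute)
qed

lemma autocorr_0: "autocorr g 0 = of_real (sqn lborel g)"
proof -
  have "autocorr g 0 = L2inner lborel g g"
    by (simp add: autocorr_def L2inner_def mult.commute)
  then show ?thesis by (simp add: L2inner_self)
qed

text \<open>Only the translated factor moves, so boundedness of the other reduces the claim to
  continuity of translation in L1.\<close>

lemma autocorr_tendsto:
  assumes G: "bounded_support B R g"
    and t: "t \<longlonglongrightarrow> 0" "\<And>m::nat. \<bar>t m\<bar> \<le> K"
  shows "(\<lambda>m. autocorr g (t m)) \<longlonglongrightarrow> autocorr g 0"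
proof -
  note g = bounded_supportD[OF G]
  have gm[measurable]: "g \<in> borel_measurable lborel" by (rule g)
  have gi: "integrable lborel g" by (rule bounded_support_integrable[OF G])
  have B: "0 \<le> B" using g(2)[of 0] norm_ge_zero order_trans by blast
  have i: "integrable lborel (\<lambda>y. cnj (g y) * g (y + s))" for s
    by (rule Bochner_Integration.integrable_bound[of _ "\<lambda>y. cmod (g y) * B"])
      (use gi B in \<open>auto simp: norm_mult intro!: mult_left_mono g\<close>)
  have i2: "integrable lborel (\<lambda>y. cmod (g (y + s) - g y))" for s
    using lborel_integrable_shift[OF gi] gi by auto
  have le: "norm (autocorr g (t m) - autocorr g 0) \<le> B * (LINT y|lborel. cmod (g (y + t m) - g y))" for m
  proof -
    have "autocorr g (t m) - autocorr g 0 = (LINT y|lborel. cnj (g y) * g (y + t m) - cnj (g y) * g (y + 0))"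
      unfolding autocorr_def by (subst Bochner_Integration.integral_diff[OF i i]) (simp add: add.commute)
    also have "norm \<dots> \<le> (LINT y|lborel. norm (cnj (g y) * g (y + t m) - cnj (g y) * g (y + 0)))"
      by (rule integral_norm_bound)
    also have "\<dots> \<le> (LINT y|lborel. B * cmod (g (y + t m) - g y))"
    proof (rule integral_mono)
      show "integrable lborel (\<lambda>y. norm (cnj (g y) * g (y + t m) - cnj (g y) * g (y + 0)))"
        by (intro integrable_norm Bochner_Integration.integrable_diff i)
      show "integrable lborel (\<lambda>y. B * cmod (g (y + t m) - g y))"
        by (intro integrable_mult_right i2)
      fix y
      show "norm (cnj (g y) * g (y + t m) - cnj (g y) * g (y + 0)) \<le> B * cmod (g (y + t m) - g y)"
        unfolding right_diff_distrib[symmetric] norm_mult by (intro mult_mono) (auto simp: B g(2))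
    qed
    finally show ?thesis by simp
  qed
  have "(\<lambda>m. B * (LINT y|lborel. cmod (g (y + t m) - g y))) \<longlonglongrightarrow> 0"
    by (rule tendsto_mult_right_zero[OF L1_translation_continuous[OF G t]])
  then have "(\<lambda>m. autocorr g (t m) - autocorr g 0) \<longlonglongrightarrow> 0"
    by (rule Lim_null_comparison[rotated]) (use le in auto)
  then show ?thesis by (simp add: LIM_zero_iff)
qed

text \<open>The squared modulus is \<open>FT (autocorr g)\<close>, and the multiplication formula
  moves the transform from the autocorrelation onto the Gaussian.\<close>

lemma gaussian_mean_FT:
  assumes G: "bounded_support B R g"
    and n: "n > 0"
  shows "integrable lborel (\<lambda>\<xi>. (cmod (FT g \<xi>))^2 * gaussw n \<xi>)"
    and "complex_of_real (LINT \<xi>|lborel. (cmod (FT g \<xi>))^2 * gaussw n \<xi>)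
      = (LINT s|lborel. autocorr g (s / (2 * pi * n)) * of_real (std_normal_density s))"
proof -
  note g = bounded_supportD[OF G]
  have gm[measurable]: "g \<in> borel_measurable lborel" by (rule g)
  have gi: "integrable lborel g" by (rule bounded_support_integrable[OF G])
  have B: "0 \<le> B" using g(2)[of 0] norm_ge_zero order_trans by blast
  let ?C = "(LINT x|lborel. cmod (g x))^2"
  show "integrable lborel (\<lambda>\<xi>. (cmod (FT g \<xi>))^2 * gaussw n \<xi>)"
  proof (rule Bochner_Integration.integrable_bound)
    show "integrable lborel (\<lambda>\<xi>. ?C * gaussw n \<xi>)"
      using gaussw_integrable[OF n] by simp
    show "AE \<xi> in lborel. norm ((cmod (FT g \<xi>))\<^sup>2 * gaussw n \<xi>) \<le> norm (?C * gaussw n \<xi>)"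
      by (auto simp: abs_mult intro!: mult_right_mono power_mono norm_FT_le)
  qed simp
  have "complex_of_real (LINT \<xi>|lborel. (cmod (FT g \<xi>))^2 * gaussw n \<xi>)
      = (LINT \<xi>|lborel. FT (autocorr g) \<xi> * of_real (gaussw n \<xi>))"
    unfolding FT_autocorr[OF gi] by (simp del: of_real_power flip: of_real_mult)
  also have "\<dots> = (LINT t|lborel. autocorr g t * FT (\<lambda>\<xi>. of_real (gaussw n \<xi>)) t)"
    by (rule multiplication_formula) (use gaussw_integrable[OF n] autocorr_integrable[OF gi] in auto)
  also have "\<dots> = (LINT t|lborel. autocorr g t * of_real (n * sqrt (2 * pi) * exp (- ((2 * pi * n * t)^2) / 2)))"
    unfolding FT_gaussw[OF n] ..
  \<comment> \<open>Substituting \<open>t = s / (2 * pi * n)\<close> normalises the exponent; its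
    Jacobian turns the factor \<open>n * sqrt (2 * pi)\<close> into
    \<open>1 / sqrt (2 * pi)\<close>, the constant of the standard normal density.\<close>
  also have "\<dots> = (1 / (2 * pi * n)) *\<^sub>R (LINT s|lborel. autocorr g (s / (2 * pi * n)) *
      of_real (n * sqrt (2 * pi) * exp (- (s^2) / 2)))"
    using n by (subst lborel_integral_real_affine[of "1 / (2 * pi * n)" _ 0]) simp_all
  also have "\<dots> = (LINT s|lborel. (1 / (2 * pi * n)) *\<^sub>R (autocorr g (s / (2 * pi * n)) *
      of_real (n * sqrt (2 * pi) * exp (- (s^2) / 2))))"
    by simp
  also have "\<dots> = (LINT s|lborel. autocorr g (s / (2 * pi * n)) * of_real (std_normal_density s))"
  proof (rule Bochner_Integration.integral_cong)
    fix s
    have "1 / (2 * pi * n) * (n * sqrt (2 * pi) * exp (- (s^2) / 2)) = std_normal_density s"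
      using n real_sqrt_mult_self[of "2 * pi"] unfolding std_normal_density_def by (simp add: field_simps)
    then have "complex_of_real (1 / (2 * pi * n)) * of_real (n * sqrt (2 * pi) * exp (- (s^2) / 2)) = of_real (std_normal_density s)"
      unfolding of_real_mult[symmetric] by (rule arg_cong)
    then show "(1 / (2 * pi * n)) *\<^sub>R (autocorr g (s / (2 * pi * n)) *
      of_real (n * sqrt (2 * pi) * exp (- (s^2) / 2))) = autocorr g (s / (2 * pi * n)) * of_real (std_normal_density s)"
      unfolding scaleR_conv_of_real by (metis mult.left_commute)
  qed simp
  finally show "complex_of_real (LINT \<xi>|lborel. (cmod (FT g \<xi>))^2 * gaussw n \<xi>)
      = (LINT s|lborel. autocorr g (s / (2 * pi * n)) * of_real (std_normal_density s))" .
qed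

text \<open>The limit of the means \<open>J n\<close> is found in two ways. Dominated convergence
  gives \<open>autocorr g 0\<close>, the squared norm of \<open>g\<close>; monotone convergence
  gives the squared norm of \<open>FT g\<close> together with its finiteness.\<close>

lemma Plancherel_bounded_support:
  assumes G: "bounded_support B R g"
  shows "L2 lborel (FT g)" "sqn lborel (FT g) = sqn lborel g"
proof -
  note g = bounded_supportD[OF G]
  have gm[measurable]: "g \<in> borel_measurable lborel" by (rule g)
  have gi: "integrable lborel g" by (rule bounded_support_integrable[OF G])
  have [measurable]: "autocorr g \<in> borel_measurable lborel"
    using autocorr_integrable[OF gi] by auto
  define J where "J n = (LINT \<xi>|lborel. (cmod (FT g \<xi>))^2 * gaussw (real (Suc n)) \<xi>)" for n
  have "(\<lambda>n. complex_of_real (J n)) \<longlonglongrightarrow> (LINT s|lborel. autocorr g 0 * of_real (std_normal_density s))"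
    unfolding J_def gaussian_mean_FT(2)[OF G of_nat_0_less_iff[THEN iffD2, OF zero_less_Suc]]
  proof (rule integral_dominated_convergence[where w="\<lambda>s. B * (LINT x|lborel. cmod (g x)) * std_normal_density s"])
    have "(\<lambda>n. autocorr g (s / (2 * pi * real (Suc n)))) \<longlonglongrightarrow> autocorr g 0" for s
    proof (rule autocorr_tendsto[OF G])
      have "(\<lambda>n. s / (2 * pi) * inverse (real (Suc n))) \<longlonglongrightarrow> s / (2 * pi) * 0"
        by (intro tendsto_mult tendsto_const LIMSEQ_inverse_real_of_nat)
      then show "(\<lambda>n. s / (2 * pi * real (Suc n))) \<longlonglongrightarrow> 0"
        by (simp add: field_simps del: of_nat_Suc)
      show "\<bar>s / (2 * pi * real (Suc n))\<bar> \<le> \<bar>s\<bar>" for n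
      proof -
        have "1 * 1 \<le> (2 * pi) * real (Suc n)" using pi_gt3 by (intro mult_mono) auto
        then have "\<bar>s\<bar> / (2 * pi * real (Suc n)) \<le> \<bar>s\<bar> / 1"
          by (intro divide_left_mono) auto
        then show ?thesis by (simp add: abs_divide abs_mult)
      qed
    qed
    then show "AE s in lborel. (\<lambda>n. autocorr g (s / (2 * pi * real (Suc n))) * complex_of_real (std_normal_density s))
        \<longlonglongrightarrow> autocorr g 0 * complex_of_real (std_normal_density s)"
      by (intro AE_I2 tendsto_mult tendsto_const)
    show "AE s in lborel. norm (autocorr g (s / (2 * pi * real (Suc n))) * complex_of_real (std_normal_density s))
         \<le> B * (LINT x|lborel. cmod (g x)) * std_normal_density s" for n
      by (auto simp: norm_mult intro!: mult_right_mono norm_autocorr_le gi g(2))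
  qed auto
  also have "(LINT s|lborel. autocorr g 0 * of_real (std_normal_density s)) = of_real (sqn lborel g)"
    by (simp add: autocorr_0)
  finally have J: "J \<longlonglongrightarrow> sqn lborel g"
    by (simp add: tendsto_of_real_iff)
  have 1: "integrable lborel (\<lambda>\<xi>. (cmod (FT g \<xi>))^2 * gaussw (real (Suc n)) \<xi>)" for n
    by (rule gaussian_mean_FT(1)[OF G]) simp
  \<comment> \<open>The weights are not normalised: each is 1 at the origin, and widening it
    increases it pointwise towards 1.\<close>
  have 2: "AE \<xi> in lborel. mono (\<lambda>n. (cmod (FT g \<xi>))^2 * gaussw (real (Suc n)) \<xi>)"
  proof (intro AE_I2 monoI mult_left_mono)
    fix \<xi> :: real and m n :: nat assume "m \<le> n"
    then show "gaussw (real (Suc m)) \<xi> \<le> gaussw (real (Suc n)) \<xi>"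
      by (auto simp: gaussw_def power_divide intro!: divide_left_mono power_mono)
  qed simp
  have 3: "AE \<xi> in lborel. (\<lambda>n. (cmod (FT g \<xi>))^2 * gaussw (real (Suc n)) \<xi>) \<longlonglongrightarrow> (cmod (FT g \<xi>))^2"
  proof (intro AE_I2)
    fix \<xi> :: real
    have "(\<lambda>n. (cmod (FT g \<xi>))^2 * exp (- ((\<xi> * inverse (real (Suc n)))^2) / 2))
       \<longlonglongrightarrow> (cmod (FT g \<xi>))^2 * exp (- ((\<xi> * 0)^2) / 2)"
      by (intro tendsto_intros LIMSEQ_inverse_real_of_nat) simp
    then show "(\<lambda>n. (cmod (FT g \<xi>))^2 * gaussw (real (Suc n)) \<xi>) \<longlonglongrightarrow> (cmod (FT g \<xi>))^2"
      unfolding gaussw_def divide_inverse[of \<xi>] by (simp del: of_nat_Suc)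
  qed
  have 4: "(\<lambda>n. LINT \<xi>|lborel. (cmod (FT g \<xi>))^2 * gaussw (real (Suc n)) \<xi>) \<longlonglongrightarrow> sqn lborel g"
    using J unfolding J_def .
  have 5: "(\<lambda>\<xi>. (cmod (FT g \<xi>))^2) \<in> borel_measurable lborel" by measurable
  show "L2 lborel (FT g)"
    using integrable_monotone_convergence[OF 1 2 3 4 5] by (simp add: L2_def)
  show "sqn lborel (FT g) = sqn lborel g"
    using integral_monotone_convergence[OF 1 2 3 4 5] by (simp add: sqn_def)
qed

text \<open>Cutting off both the support and the values reduces Plancherel's identity to bounded
  functions of bounded support; Fatou's lemma transfers the estimate to the limit.\<close>

definition cutoff :: "nat \<Rightarrow> (real \<Rightarrow> complex) \<Rightarrow> real \<Rightarrow> complex" where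
  "cutoff n g x = (if \<bar>x\<bar> \<le> real n \<and> cmod (g x) \<le> real n then g x else 0)"

lemma cutoff_measurable[measurable]:
  assumes [measurable]: "g \<in> borel_measurable lborel"
  shows "cutoff n g \<in> borel_measurable lborel"
  unfolding cutoff_def[abs_def] by measurable

lemma cutoff_bounds: "cmod (cutoff n g x) \<le> real n" "\<bar>x\<bar> > real n \<Longrightarrow> cutoff n g x = 0"
  by (auto simp: cutoff_def)

lemma cutoff_bounded_support:
  "g \<in> borel_measurable lborel \<Longrightarrow> bounded_support (real n) (real n) (cutoff n g)"
  by (intro bounded_supportI cutoff_measurable cutoff_bounds)

text \<open>Cutoffs are nested: where \<open>cutoff m g\<close> already equals \<open>g\<close>, so
  does \<open>cutoff n g\<close>; elsewhere the left side is at most the modulus of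
  \<open>g\<close>.\<close>

lemma cutoff_diff_le:
  "m \<le> n \<Longrightarrow> cmod (cutoff n g x - cutoff m g x) \<le> cmod (g x - cutoff m g x)"
  by (auto simp: cutoff_def)

lemma cutoff_diff_le': "cmod (g x - cutoff m g x) \<le> cmod (g x)"
  by (auto simp: cutoff_def)

lemma cutoff_tendsto: "(\<lambda>n. cutoff n g x) \<longlonglongrightarrow> g x"
proof (rule tendsto_eventually)
  obtain N :: nat where N: "\<bar>x\<bar> + cmod (g x) \<le> real N" using real_arch_simple by blast
  show "\<forall>\<^sub>F n in sequentially. cutoff n g x = g x"
    using eventually_ge_at_top[of N]
  proof eventually_elim
    case (elim n)
    then have "real N \<le> real n" by simp
    with N have "\<bar>x\<bar> \<le> real n" "cmod (g x) \<le> real n"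
      using norm_ge_zero[of "g x"] abs_ge_zero[of x] by linarith+
    then show ?case by (simp add: cutoff_def)
  qed
qed

lemma cutoff_L1:
  assumes g: "integrable lborel g"
  shows "(\<lambda>n. LINT x|lborel. cmod (cutoff n g x - g x)) \<longlonglongrightarrow> 0"
proof -
  have [measurable]: "g \<in> borel_measurable lborel" using g by auto
  have "(\<lambda>n. LINT x|lborel. cmod (cutoff n g x - g x)) \<longlonglongrightarrow> (LINT x::real|lborel. 0)"
  proof (rule integral_dominated_convergence[where w="\<lambda>x. cmod (g x)"])
    show "AE x in lborel. (\<lambda>n. cmod (cutoff n g x - g x)) \<longlonglongrightarrow> 0"
      using cutoff_tendsto by (auto intro!: tendsto_norm_zero LIM_zero)
  qed (use g cutoff_diff_le' in \<open>auto simp: norm_minus_commute\<close>)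
  then show ?thesis by simp
qed

lemma cutoff_L2:
  assumes g: "L2 lborel g"
  shows "L2 lborel (cutoff n g)" "(\<lambda>n. sqn lborel (\<lambda>x. cutoff n g x - g x)) \<longlonglongrightarrow> 0"
proof -
  have [measurable]: "g \<in> borel_measurable lborel" using g by (auto simp: L2_def)
  show "L2 lborel (cutoff n g)"
    by (rule bounded_support_L2[OF cutoff_bounded_support]) simp
  have "(\<lambda>n. LINT x|lborel. (cmod (cutoff n g x - g x))^2) \<longlonglongrightarrow> (LINT x::real|lborel. 0)"
  proof (rule integral_dominated_convergence[where w="\<lambda>x. (cmod (g x))^2"])
    have "(\<lambda>n. (cmod (cutoff n g x - g x))^2) \<longlonglongrightarrow> 0\<^sup>2" for x
      using cutoff_tendsto by (intro tendsto_power tendsto_norm_zero LIM_zero)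
    then show "AE x in lborel. (\<lambda>n. (cmod (cutoff n g x - g x))^2) \<longlonglongrightarrow> 0" by simp
  qed (use g cutoff_diff_le' in \<open>auto simp: norm_minus_commute L2_def intro!: power_mono\<close>)
  then show "(\<lambda>n. sqn lborel (\<lambda>x. cutoff n g x - g x)) \<longlonglongrightarrow> 0" by (simp add: sqn_def)
qed

theorem Plancherel:
  assumes g: "integrable lborel g" "L2 lborel g"
  shows "L2 lborel (FT g)" "sqn lborel (FT g) = sqn lborel g"
proof -
  have gm[measurable]: "g \<in> borel_measurable lborel" using g by auto
  have ci: "integrable lborel (cutoff n g)" for n
    by (rule bounded_support_integrable[OF cutoff_bounded_support]) simp
  note cP = Plancherel_bounded_support[OF cutoff_bounded_support[OF gm]]
  have cdP: "L2 lborel (FT (\<lambda>x. cutoff m g x - cutoff n g x)) \<and> sqn lborel (FT (\<lambda>x. cutoff m g x - cutoff n g x))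
      = sqn lborel (\<lambda>x. cutoff m g x - cutoff n g x)" for m n
  proof -
    have b: "cmod (cutoff m g x - cutoff n g x) \<le> real m + real n" for x
      by (rule norm_triangle_le_diff) (use cutoff_bounds(1)[of m g x] cutoff_bounds(1)[of n g x] in linarith)
    have s: "\<bar>x\<bar> > real (max m n) \<Longrightarrow> cutoff m g x - cutoff n g x = 0" for x
      by (simp add: cutoff_bounds)
    have "bounded_support (real m + real n) (real (max m n)) (\<lambda>x. cutoff m g x - cutoff n g x)"
      by (intro bounded_supportI b s) measurable
    from Plancherel_bounded_support[OF this] show ?thesis by simp
  qed
  have le: "sqn lborel (\<lambda>x. cutoff m g x - cutoff n g x) \<le> sqn lborel (\<lambda>x. cutoff n g x - g x)" if "m \<ge> n" for m n
    unfolding sqn_def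
  proof (rule integral_mono)
    show "integrable lborel (\<lambda>x. (cmod (cutoff m g x - cutoff n g x))\<^sup>2)"
      "integrable lborel (\<lambda>x. (cmod (cutoff n g x - g x))\<^sup>2)"
      by (intro L2_integrable L2_diff cutoff_L2(1) g)+
    show "(cmod (cutoff m g x - cutoff n g x))\<^sup>2 \<le> (cmod (cutoff n g x - g x))\<^sup>2" for x
      using cutoff_diff_le[OF that, of g x] by (intro power_mono) (auto simp: norm_minus_commute)
  qed
  \<comment> \<open>Transforms are bounded pointwise by the L1 norm, so convergence holds at every
    point; this ties the L2 limit to \<open>FT g\<close> itself.\<close>
  have pw: "(\<lambda>m. FT (cutoff m g) \<xi>) \<longlonglongrightarrow> FT g \<xi>" for \<xi>
  proof -
    have "norm (FT (cutoff m g) \<xi> - FT g \<xi>) \<le> (LINT x|lborel. cmod (cutoff m g x - g x))" for m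
      unfolding FT_diff[OF ci g(1), symmetric] by (rule norm_FT_le)
    then have "(\<lambda>m. FT (cutoff m g) \<xi> - FT g \<xi>) \<longlonglongrightarrow> 0"
      by (intro Lim_null_comparison[OF _ cutoff_L1[OF g(1)]]) simp
    then show ?thesis by (simp add: LIM_zero_iff)
  qed
  \<comment> \<open>Fatou in \<open>m\<close> with \<open>n\<close> fixed; the resulting bound tends
    to 0 as \<open>n\<close> grows.\<close>
  have fat: "L2 lborel (\<lambda>\<xi>. FT g \<xi> - FT (cutoff n g) \<xi>) \<and>
      sqn lborel (\<lambda>\<xi>. FT g \<xi> - FT (cutoff n g) \<xi>) \<le> sqn lborel (\<lambda>x. cutoff n g x - g x)" for n
  proof -
    have 1: "L2 lborel (FT (\<lambda>x. cutoff m g x - cutoff n g x))" for m using cdP by blast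
    have 2: "(\<lambda>\<xi>. FT g \<xi> - FT (cutoff n g) \<xi>) \<in> borel_measurable lborel" by measurable
    have 3: "AE \<xi> in lborel. (\<lambda>m. FT (\<lambda>x. cutoff m g x - cutoff n g x) \<xi>) \<longlonglongrightarrow> FT g \<xi> - FT (cutoff n g) \<xi>"
      unfolding FT_diff[OF ci ci] by (intro AE_I2 tendsto_diff pw tendsto_const)
    have 4: "\<forall>\<^sub>F m in sequentially. sqn lborel (FT (\<lambda>x. cutoff m g x - cutoff n g x)) \<le> sqn lborel (\<lambda>x. cutoff n g x - g x)"
      using eventually_ge_at_top[of n] by eventually_elim (use le cdP in simp)
    show ?thesis using L2_Fatou[OF 1 2 3 4] by simp
  qed
  have "L2 lborel (\<lambda>\<xi>. (FT g \<xi> - FT (cutoff 0 g) \<xi>) + FT (cutoff 0 g) \<xi>)"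
    by (intro L2_add cP(1)) (use fat[of 0] in auto)
  then show L: "L2 lborel (FT g)" by simp
  have "(\<lambda>n. sqn lborel (\<lambda>\<xi>. FT (cutoff n g) \<xi> - FT g \<xi>)) \<longlonglongrightarrow> 0"
    by (rule Lim_null_comparison[OF _ cutoff_L2(2)[OF g(2)]])
       (use fat in \<open>auto simp: sqn_nonneg sqn_def norm_minus_commute\<close>)
  from tendsto_sqn[OF cP(1) L this]
  have "(\<lambda>n. sqn lborel (FT (cutoff n g))) \<longlonglongrightarrow> sqn lborel (FT g)" by simp
  moreover have "(\<lambda>n. sqn lborel (FT (cutoff n g))) \<longlonglongrightarrow> sqn lborel g"
    using tendsto_sqn[OF cutoff_L2(1)[OF g(2)] g(2) cutoff_L2(2)[OF g(2)]] cP(2) by simp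
  ultimately show "sqn lborel (FT g) = sqn lborel g" by (rule LIMSEQ_unique)
qed

text \<open>By polarization: Plancherel applies to each of the four combinations of \<open>f\<close>
  and \<open>g\<close>.\<close>

theorem Parseval:
  assumes f: "integrable lborel f" "L2 lborel f" and g: "integrable lborel g" "L2 lborel g"
  shows "L2inner lborel (FT f) (FT g) = L2inner lborel f g"
proof -
  have ig: "integrable lborel (\<lambda>x. \<i> * g x)" using g by simp
  note Lg = L2_scale[OF g(2), of \<i>]
  have "sqn lborel (\<lambda>x. FT f x + FT g x) = sqn lborel (\<lambda>x. f x + g x)"
    using Plancherel(2)[OF Bochner_Integration.integrable_add[OF f(1) g(1)] L2_add[OF f(2) g(2)]] by (simp add: sqn_def FT_add f g)
  moreover have "sqn lborel (\<lambda>x. FT f x - FT g x) = sqn lborel (\<lambda>x. f x - g x)"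
    using Plancherel(2)[OF Bochner_Integration.integrable_diff[OF f(1) g(1)] L2_diff[OF f(2) g(2)]] by (simp add: sqn_def FT_diff f g)
  moreover have "sqn lborel (\<lambda>x. FT f x + \<i> * FT g x) = sqn lborel (\<lambda>x. f x + \<i> * g x)"
    using Plancherel(2)[OF Bochner_Integration.integrable_add[OF f(1) ig] L2_add[OF f(2) Lg]] by (simp add: sqn_def FT_add f ig FT_scale)
  moreover have "sqn lborel (\<lambda>x. FT f x - \<i> * FT g x) = sqn lborel (\<lambda>x. f x - \<i> * g x)"
    using Plancherel(2)[OF Bochner_Integration.integrable_diff[OF f(1) ig] L2_diff[OF f(2) Lg]] by (simp add: sqn_def FT_diff f ig FT_scale)
  ultimately have "4 * L2inner lborel (FT f) (FT g) = 4 * L2inner lborel f g"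
    unfolding L2inner_polarization[OF f(2) g(2)] L2inner_polarization[OF Plancherel(1)[OF f] Plancherel(1)[OF g]]
    by simp
  then show ?thesis by simp
qed

section \<open>The Fourier transform on square-integrable functions\<close>

text \<open>Unlike in \<open>cutoff\<close>, only the support is cut and \<open>R\<close> is real,
  to match the integrals over \<open>{-R..R}\<close> in \<open>is_fourier\<close>.\<close>

definition trunc :: "real \<Rightarrow> (real \<Rightarrow> complex) \<Rightarrow> real \<Rightarrow> complex" where
  "trunc R g x = (if \<bar>x\<bar> \<le> R then g x else 0)"

lemma trunc_measurable[measurable]:
  assumes [measurable]: "g \<in> borel_measurable lborel"
  shows "trunc R g \<in> borel_measurable lborel"
  unfolding trunc_def[abs_def] by measurable

lemma L2_trunc:
  assumes g: "L2 lborel g"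
  shows "L2 lborel (trunc R g)"
proof -
  have [measurable]: "g \<in> borel_measurable lborel" using g by (auto simp: L2_def)
  have "integrable lborel (\<lambda>x. (cmod (trunc R g x))^2)"
    by (rule Bochner_Integration.integrable_bound[OF L2_integrable[OF g]]) (auto simp: trunc_def)
  then show ?thesis by (simp add: L2_def)
qed

text \<open>The indicator of a bounded interval is square-integrable, so the truncation is a product
  of two square-integrable functions.\<close>

lemma integrable_trunc:
  assumes g: "L2 lborel g"
  shows "integrable lborel (trunc R g)"
proof -
  have "L2 lborel (\<lambda>x. of_real (indicator {-R..R} x))"
    by (rule bounded_support_L2[where B=1 and R=R]) (auto intro!: bounded_supportI simp: indicator_def)
  from L2_mult_integrable[OF this g] show ?thesis
    by (rule Bochner_Integration.integrable_cong[THEN iffD1, rotated -1])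
       (auto simp: trunc_def indicator_def abs_le_iff)
qed

lemma trunc_tendsto_L2:
  assumes g: "L2 lborel g"
  shows "((\<lambda>R. sqn lborel (\<lambda>x. trunc R g x - g x)) \<longlongrightarrow> 0) at_top"
proof -
  have [measurable]: "g \<in> borel_measurable lborel" using g by (auto simp: L2_def)
  have "((\<lambda>R. LINT x|lborel. (cmod (trunc R g x - g x))^2) \<longlongrightarrow> (LINT x::real|lborel. 0)) at_top"
  proof (rule integral_dominated_convergence_at_top[where w="\<lambda>x. (cmod (g x))^2"])
    have "\<forall>\<^sub>F R in at_top. (cmod (trunc R g x - g x))^2 = 0" for x
      using eventually_ge_at_top[of "\<bar>x\<bar>"] by eventually_elim (simp add: trunc_def)
    then show "AE x in lborel. ((\<lambda>R. (cmod (trunc R g x - g x))^2) \<longlongrightarrow> 0) at_top"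
      by (intro AE_I2 tendsto_eventually)
    show "\<forall>\<^sub>F R in at_top. AE x in lborel. norm ((cmod (trunc R g x - g x))\<^sup>2) \<le> (cmod (g x))\<^sup>2"
      by (intro always_eventually allI AE_I2) (auto simp: trunc_def)
  qed (use g in \<open>auto simp: L2_def\<close>)
  then show ?thesis by (simp add: sqn_def)
qed

lemma truncated_fourier_integral:
  "(LINT x:{-R..R}|lborel. g x * exp (- 2 * complex_of_real pi * \<i> * complex_of_real x * complex_of_real \<xi>))
     = FT (trunc R g) \<xi>"
  unfolding FT_def set_lebesgue_integral_def
  by (intro Bochner_Integration.integral_cong)
     (auto simp: trunc_def indicator_def abs_le_iff cis_conv_exp algebra_simps)

text \<open>Plancherel for the truncations makes the extended integral in \<open>is_fourier\<close>
  finite, so a real squared norm can replace it.\<close>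

lemma is_fourier_iff:
  "is_fourier g h \<longleftrightarrow> L2 lborel g \<and> L2 lborel h \<and>
     ((\<lambda>R. sqn lborel (\<lambda>\<xi>. FT (trunc R g) \<xi> - h \<xi>)) \<longlongrightarrow> 0) at_top"
proof (cases "L2 lborel g \<and> L2 lborel h")
  case True
  then have "(\<integral>\<^sup>+ \<xi>. ennreal ((cmod (h \<xi> - FT (trunc R g) \<xi>))^2) \<partial>lborel)
      = ennreal (sqn lborel (\<lambda>\<xi>. FT (trunc R g) \<xi> - h \<xi>))" for R
    by (subst nn_integral_cmod_sq)
       (auto intro!: L2_diff Plancherel integrable_trunc L2_trunc simp: sqn_def norm_minus_commute)
  moreover have "((\<lambda>R. ennreal (sqn lborel (\<lambda>\<xi>. FT (trunc R g) \<xi> - h \<xi>))) \<longlongrightarrow> 0) at_top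
     \<longleftrightarrow> ((\<lambda>R. sqn lborel (\<lambda>\<xi>. FT (trunc R g) \<xi> - h \<xi>)) \<longlongrightarrow> 0) at_top"
    using tendsto_ennreal_iff[of "\<lambda>R. sqn lborel (\<lambda>\<xi>. FT (trunc R g) \<xi> - h \<xi>)" at_top 0]
    by (simp add: sqn_nonneg)
  ultimately show ?thesis
    using True unfolding is_fourier_def truncated_fourier_integral by simp
qed (auto simp: is_fourier_def)

text \<open>Parseval for transforms that exist only as limits. The approximants are arbitrary, so
  one factor may be a truncation that is afterwards translated and dilated.\<close>

lemma Parseval_limit:
  assumes f: "\<And>n. integrable lborel (f n)" "\<And>n. L2 lborel (f n)" "L2 lborel f'"
      "((\<lambda>n. sqn lborel (\<lambda>x. f n x - f' x)) \<longlongrightarrow> 0) F"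
    and g: "\<And>n. integrable lborel (g n)" "\<And>n. L2 lborel (g n)" "L2 lborel g'"
      "((\<lambda>n. sqn lborel (\<lambda>x. g n x - g' x)) \<longlongrightarrow> 0) F"
    and A: "L2 lborel A" "((\<lambda>n. sqn lborel (\<lambda>x. FT (f n) x - A x)) \<longlongrightarrow> 0) F"
    and B: "L2 lborel B" "((\<lambda>n. sqn lborel (\<lambda>x. FT (g n) x - B x)) \<longlongrightarrow> 0) F"
    and F: "F \<noteq> bot"
  shows "L2inner lborel f' g' = L2inner lborel A B"
proof -
  have "((\<lambda>n. L2inner lborel (f n) (g n)) \<longlongrightarrow> L2inner lborel f' g') F"
    by (rule tendsto_L2inner) fact+
  moreover have "((\<lambda>n. L2inner lborel (FT (f n)) (FT (g n))) \<longlongrightarrow> L2inner lborel A B) F"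
    by (rule tendsto_L2inner) (fact | rule Plancherel f g)+
  ultimately show ?thesis
    unfolding Parseval[OF f(1,2) g(1,2)] using F tendsto_unique by blast
qed

section \<open>Translations, dilations and wavelet coefficients\<close>

lemma L2_affine:
  assumes f: "L2 lborel f" and a: "a \<noteq> 0"
  shows "L2 lborel (\<lambda>x. f (t + a * x))" "sqn lborel (\<lambda>x. f (t + a * x)) = sqn lborel f / \<bar>a\<bar>"
proof -
  have [measurable]: "f \<in> borel_measurable lborel" using f by (auto simp: L2_def)
  show "L2 lborel (\<lambda>x. f (t + a * x))"
    using lborel_integrable_real_affine[OF L2_integrable[OF f] a] by (simp add: L2_def)
  show "sqn lborel (\<lambda>x. f (t + a * x)) = sqn lborel f / \<bar>a\<bar>"
    unfolding sqn_def using a by (subst (2) lborel_integral_real_affine[OF a, of _ t]) simp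
qed

lemma sqn_scale: "sqn M (\<lambda>x. c * f x) = (cmod c)^2 * sqn M f"
  by (simp add: sqn_def norm_mult power_mult_distrib)

lemma sqn_unimodular: "sqn M (\<lambda>x. cis (b x) * f x) = sqn M f"
  by (simp add: sqn_def norm_mult)

lemma FT_affine:
  assumes v: "v > 0"
  shows "FT (\<lambda>x. f ((x - u) / v)) \<xi> = of_real v * cis (- 2 * pi * u * \<xi>) * FT f (v * \<xi>)"
proof -
  have "FT (\<lambda>x. f ((x - u) / v)) \<xi> = v *\<^sub>R (LINT x|lborel. f x * cis (- 2 * pi * (u + v * x) * \<xi>))"
    unfolding FT_def using v by (subst lborel_integral_real_affine[of v _ u]) simp_all
  also have "(LINT x|lborel. f x * cis (- 2 * pi * (u + v * x) * \<xi>))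
    = (LINT x|lborel. cis (- 2 * pi * u * \<xi>) * (f x * cis (- 2 * pi * x * (v * \<xi>))))"
    by (intro Bochner_Integration.integral_cong) (auto simp: cis_mult algebra_simps)
  also have "\<dots> = cis (- 2 * pi * u * \<xi>) * FT f (v * \<xi>)"
    unfolding FT_def by (rule integral_mult_right_zero)
  finally show ?thesis by (simp add: scaleR_conv_of_real)
qed

text \<open>Under \<open>cnj\<close> stands the transform of the translated and dilated wavelet, so
  this is the wavelet coefficient on the Fourier side. The value 0 off the half-plane agrees with
  \<open>wavelet_coeff\<close>.\<close>

definition wave_transform :: "nat \<Rightarrow> (real \<Rightarrow> complex) \<Rightarrow> real \<times> real \<Rightarrow> complex" where
  "wave_transform k h p = (if snd p > 0 then
     LINT \<xi>|lborel. h \<xi> * cnj (of_real (sqrt (snd p)) * cis (- 2 * pi * fst p * \<xi>) * psi_hat k (snd p * \<xi>)) else 0)"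

text \<open>Parseval for \<open>f\<close> and the translated, dilated wavelet. It holds at every
  single point, so the wavelet space can be described exactly as a set of functions.\<close>

lemma wavelet_coeff_eq_wave_transform:
  assumes psi: "is_fourier psi (psi_hat k)" and f: "is_fourier f h"
  shows "wavelet_coeff psi f = wave_transform k h"
proof
  fix p :: "real \<times> real"
  obtain u v where p: "p = (u, v)" by (cases p)
  show "wavelet_coeff psi f p = wave_transform k h p"
  proof (cases "v > 0")
    case False
    then show ?thesis by (simp add: p wavelet_coeff_def wave_transform_def)
  next
    case v: True
    define c where "c = complex_of_real (v powr (-1/2))"
    \<comment> \<open>The normalisation of the wavelet meets the Jacobian \<open>v\<close> of the
      dilation.\<close>
    have "v powr (-1/2) * v = v powr (-1/2) * v powr 1" using v by simp
    also have "\<dots> = sqrt v" unfolding powr_add[symmetric] using v by (simp add: powr_half_sqrt)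
    finally have cv: "c * of_real v = of_real (sqrt v)" unfolding c_def of_real_mult[symmetric] by simp
    define G where "G R x = c * trunc R psi ((x - u) / v)" for R x
    define B where "B \<xi> = of_real (sqrt v) * cis (- 2 * pi * u * \<xi>) * psi_hat k (v * \<xi>)" for \<xi>
    have aff: "(x - u) / v = - u / v + (1 / v) * x" for x
      using v by (simp add: field_simps)
    have L: "L2 lborel psi" "L2 lborel (psi_hat k)" "L2 lborel f" "L2 lborel h"
      and lims: "((\<lambda>R. sqn lborel (\<lambda>\<xi>. FT (trunc R psi) \<xi> - psi_hat k \<xi>)) \<longlongrightarrow> 0) at_top"
      "((\<lambda>R. sqn lborel (\<lambda>\<xi>. FT (trunc R f) \<xi> - h \<xi>)) \<longlongrightarrow> 0) at_top"
      using psi f unfolding is_fourier_iff by auto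
    have Laff: "L2 lborel (\<lambda>x. g ((x - u) / v))" "sqn lborel (\<lambda>x. g ((x - u) / v)) = v * sqn lborel g"
      if "L2 lborel g" for g
      unfolding aff using L2_affine[OF that, of "1 / v" "- u / v"] v by auto
    \<comment> \<open>The summand 0 brings the argument into the shape \<open>t + a * x\<close> of
      \<open>L2_affine\<close>.\<close>
    have FTG: "FT (G R) \<xi> = of_real (sqrt v) * (cis (- 2 * pi * u * \<xi>) * FT (trunc R psi) (0 + v * \<xi>))" for R \<xi>
      unfolding G_def FT_scale FT_affine[OF v] cv[symmetric] by simp
    have Beq: "B \<xi> = of_real (sqrt v) * (cis (- 2 * pi * u * \<xi>) * psi_hat k (0 + v * \<xi>))" for \<xi>
      unfolding B_def by simp
    have LB: "L2 lborel B"
    proof -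
      have "L2 lborel (\<lambda>\<xi>. psi_hat k (0 + v * \<xi>))"
        by (rule L2_affine[OF L(2)]) (use v in simp)
      then have "L2 lborel (\<lambda>\<xi>. cis (- 2 * pi * u * \<xi>) * psi_hat k (0 + v * \<xi>))"
        by (rule L2_bounded_mult[where B=1]) auto
      then show ?thesis unfolding Beq[abs_def] by (rule L2_scale)
    qed
    have "L2inner lborel f (\<lambda>x. c * psi ((x - u) / v)) = L2inner lborel h B"
    proof (rule Parseval_limit[where f="\<lambda>R. trunc R f" and g=G and F=at_top])
      show "integrable lborel (G R)" for R
        unfolding G_def aff using lborel_integrable_real_affine[OF integrable_trunc[OF L(1)], of "1 / v" R "- u / v"] v
        by (intro integrable_mult_right) auto
      show "L2 lborel (G R)" for R
        unfolding G_def by (intro L2_scale Laff L2_trunc L)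
      show "L2 lborel (\<lambda>x. c * psi ((x - u) / v))"
        by (intro L2_scale Laff L)
      have "sqn lborel (\<lambda>x. G R x - c * psi ((x - u) / v))
          = (cmod c)^2 * (v * sqn lborel (\<lambda>x. trunc R psi x - psi x))" for R
        unfolding G_def right_diff_distrib[symmetric] sqn_scale
        using Laff(2)[OF L2_diff[OF L2_trunc[OF L(1)] L(1)]] by simp
      then show "((\<lambda>R. sqn lborel (\<lambda>x. G R x - c * psi ((x - u) / v))) \<longlongrightarrow> 0) at_top"
        using tendsto_mult_right_zero[OF tendsto_mult_right_zero[OF trunc_tendsto_L2[OF L(1)]]] by simp
      have "sqn lborel (\<lambda>\<xi>. FT (G R) \<xi> - B \<xi>)
          = (cmod (of_real (sqrt v)))^2 * (sqn lborel (\<lambda>\<xi>. FT (trunc R psi) \<xi> - psi_hat k \<xi>) / \<bar>v\<bar>)" for R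
        unfolding FTG Beq right_diff_distrib[symmetric] sqn_scale sqn_unimodular
        using L2_affine(2)[OF L2_diff[OF Plancherel(1)[OF integrable_trunc[OF L(1)] L2_trunc[OF L(1)]] L(2)], of v R 0] v by simp
      then show "((\<lambda>R. sqn lborel (\<lambda>\<xi>. FT (G R) \<xi> - B \<xi>)) \<longlongrightarrow> 0) at_top"
        using tendsto_mult_right_zero[OF tendsto_divide_zero[OF lims(1)]] by simp
    qed (intro integrable_trunc L2_trunc L LB trunc_tendsto_L2 lims trivial_limit_at_top_linorder)+
    then show ?thesis
      using v by (simp add: p wavelet_coeff_def wave_transform_def L2inner_def B_def c_def)
  qed
qed

lemma FT_cnj: "FT (\<lambda>x. cnj (h x)) \<xi> = cnj (FT h (- \<xi>))"
  unfolding FT_def Bochner_Integration.integral_cnj[symmetric] by (simp add: cis_cnj)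

text \<open>The candidate \<open>f\<close> is the limit of the inverse transforms of truncations of \<open>h\<close>. The pairing of
  the transform of \<open>trunc R f\<close> with \<open>h\<close> equals the squared norm of \<open>trunc R f\<close>, so expanding the square
  gives the distance to \<open>h\<close> as a difference of norms, and no inversion formula is needed.\<close>

theorem fourier_inverse_exists:
  assumes h: "L2 lborel h"
  obtains f where "is_fourier f h"
proof -
  \<comment> \<open>Reflecting the argument turns \<open>FT\<close> into the inverse
    transform.\<close>
  define g where "g n x = FT (trunc (real n) h) (0 + (-1) * x)" for n x
  have nat: "filterlim (\<lambda>n. real n) at_top sequentially" by (rule filterlim_real_sequentially)
  have tn: "(\<lambda>n. sqn lborel (\<lambda>x. trunc (real n) h x - h x)) \<longlonglongrightarrow> 0"
    by (rule filterlim_compose[OF trunc_tendsto_L2[OF h] nat])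
  note P = Plancherel[OF integrable_trunc[OF h] L2_trunc[OF h]]
  have Lg: "L2 lborel (g n)" for n
    unfolding g_def by (rule L2_affine[OF P(1)]) simp
  have sg: "sqn lborel (\<lambda>x. g m x - g n x) \<le> 2 * sqn lborel (\<lambda>x. trunc m h x - h x) + 2 * sqn lborel (\<lambda>x. trunc n h x - h x)" for m n
  proof -
    have i: "integrable lborel (\<lambda>x. trunc m h x - trunc n h x)" "L2 lborel (\<lambda>x. trunc m h x - trunc n h x)"
      by (intro Bochner_Integration.integrable_diff L2_diff integrable_trunc L2_trunc h)+
    have "sqn lborel (\<lambda>x. g m x - g n x) = sqn lborel (\<lambda>x. FT (\<lambda>x. trunc m h x - trunc n h x) (0 + (-1) * x))"
      unfolding g_def FT_diff[OF integrable_trunc[OF h] integrable_trunc[OF h]] ..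
    also have "\<dots> = sqn lborel (\<lambda>x. trunc m h x - trunc n h x)"
      using L2_affine(2)[OF Plancherel(1)[OF i], of "-1" 0] Plancherel(2)[OF i] by simp
    also have "\<dots> = sqn lborel (\<lambda>x. (trunc m h x - h x) + (-1) * (trunc n h x - h x))" by simp
    also have "\<dots> \<le> 2 * sqn lborel (\<lambda>x. trunc m h x - h x) + 2 * sqn lborel (\<lambda>x. (-1) * (trunc n h x - h x))"
      by (intro sqn_add_le L2_scale L2_diff L2_trunc h)
    finally show ?thesis unfolding sqn_scale by simp
  qed
  obtain f where f: "L2 lborel f" "(\<lambda>n. sqn lborel (\<lambda>x. g n x - f x)) \<longlonglongrightarrow> 0"
  proof (rule L2_complete[of lborel g, OF Lg])
    fix e :: real assume "e > 0"
    then have "e / 4 > 0" by simp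
    from LIMSEQ_D[OF tn this] obtain N where
      "\<And>n. n \<ge> N \<Longrightarrow> sqn lborel (\<lambda>x. trunc (real n) h x - h x) < e / 4"
      by (auto simp: sqn_nonneg)
    note N = this
    have "sqn lborel (\<lambda>x. g m x - g n x) \<le> e" if "m \<ge> N" "n \<ge> N" for m n
      using sg[of m n] N[OF that(1)] N[OF that(2)] by linarith
    then show "\<exists>N. \<forall>m\<ge>N. \<forall>n\<ge>N. sqn lborel (\<lambda>x. g m x - g n x) \<le> e" by blast
  qed
  have norm_f: "sqn lborel f = sqn lborel h"
  proof -
    have "sqn lborel (g n) = sqn lborel (trunc (real n) h)" for n
      unfolding g_def using L2_affine(2)[OF P(1), of "-1" "real n" 0] P(2) by simp
    then have "(\<lambda>n. sqn lborel (trunc (real n) h)) \<longlonglongrightarrow> sqn lborel f"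
      using tendsto_sqn[OF Lg f] by simp
    then show ?thesis by (rule LIMSEQ_unique[OF _ tendsto_sqn[OF L2_trunc[OF h] h tn]])
  qed
  note fR = integrable_trunc[OF f(1)] L2_trunc[OF f(1)]
  have key: "L2inner lborel (FT (trunc R f)) h = of_real (sqn lborel (trunc R f))" for R
  proof -
    \<comment> \<open>Conjugation reflects the transform, so the multiplication formula becomes an
      adjoint relation between \<open>FT\<close> and the inverse transform.\<close>
    have eq: "L2inner lborel (FT (trunc R f)) (trunc (real n) h) = L2inner lborel (trunc R f) (g n)" for n
    proof -
      have "integrable lborel (\<lambda>x. cnj (trunc (real n) h x))"
        using integrable_trunc[OF h] by simp
      from multiplication_formula[OF fR(1) this]
      show ?thesis unfolding FT_cnj L2inner_def g_def by simp
    qed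
    have "(\<lambda>n. L2inner lborel (FT (trunc R f)) (trunc (real n) h)) \<longlonglongrightarrow> L2inner lborel (FT (trunc R f)) h"
      by (rule tendsto_L2inner[OF _ _ _ L2_trunc[OF h] h tn]) (use Plancherel(1)[OF fR] in \<open>simp_all add: sqn_def\<close>)
    moreover have "(\<lambda>n. L2inner lborel (trunc R f) (g n)) \<longlonglongrightarrow> L2inner lborel (trunc R f) f"
      by (rule tendsto_L2inner[OF _ _ _ Lg f]) (use fR(2) in \<open>simp_all add: sqn_def\<close>)
    ultimately have "L2inner lborel (FT (trunc R f)) h = L2inner lborel (trunc R f) f"
      unfolding eq by (rule LIMSEQ_unique)
    \<comment> \<open>Pairing with the truncation sees \<open>f\<close> only where the two
      agree.\<close>
    also have "\<dots> = L2inner lborel (trunc R f) (trunc R f)"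
      unfolding L2inner_def by (intro Bochner_Integration.integral_cong) (auto simp: trunc_def)
    finally show ?thesis by (simp add: L2inner_self)
  qed
  have "sqn lborel (\<lambda>\<xi>. FT (trunc R f) \<xi> - h \<xi>) = sqn lborel f - sqn lborel (trunc R f)" for R
    unfolding sqn_diff_expand[OF Plancherel(1)[OF fR] h] key Plancherel(2)[OF fR] norm_f by simp
  moreover have "((\<lambda>R. sqn lborel f - sqn lborel (trunc R f)) \<longlongrightarrow> sqn lborel f - sqn lborel f) at_top"
    by (intro tendsto_diff tendsto_const tendsto_sqn[OF fR(2) f(1) trunc_tendsto_L2[OF f(1)]])
  ultimately have "is_fourier f h"
    using f h by (simp add: is_fourier_iff)
  then show ?thesis by (rule that)
qed

text \<open>Vanishing is demanded at every point, not almost everywhere: this fixes representatives,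
  so that a function on \<open>Rplus\<close> corresponds to its extension by 0.\<close>

definition L2plus :: "(real \<Rightarrow> complex) set" where
  "L2plus = {h. L2 lborel h \<and> (\<forall>\<xi>\<le>0. h \<xi> = 0)}"

text \<open>\<open>psi_hat k\<close> vanishes off the positive axis, so cutting \<open>h\<close>
  there leaves the wavelet transform unchanged; conversely every element of \<open>L2plus\<close> is
  the transform of a member of \<open>H2plus\<close>.\<close>

lemma wavelet_space_eq:
  assumes psi: "is_fourier psi (psi_hat k)"
  shows "wavelet_space psi = wave_transform k ` L2plus"
proof (intro equalityI subsetI)
  fix F assume "F \<in> wavelet_space psi"
  then obtain f h where F: "F = wavelet_coeff psi f" and f: "is_fourier f h"
    by (auto simp: wavelet_space_def H2plus_def)
  define h' where "h' \<xi> = (if \<xi> > 0 then h \<xi> else 0)" for \<xi>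
  have L: "L2 lborel h" using f by (simp add: is_fourier_def)
  then have [measurable]: "h \<in> borel_measurable lborel" by (simp add: L2_def)
  have "L2 lborel (\<lambda>\<xi>. of_real (indicator {0<..} \<xi>) * h \<xi>)"
    by (rule L2_bounded_mult[OF L, where B=1]) (auto simp: indicator_def)
  also have "(\<lambda>\<xi>. of_real (indicator {0<..} \<xi>) * h \<xi>) = h'"
    by (auto simp: h'_def indicator_def)
  finally have "h' \<in> L2plus" 
    unfolding L2plus_def mem_Collect_eq by (intro conjI) (assumption, simp add: h'_def)
  moreover have "wave_transform k h = wave_transform k h'"
    by (auto simp: wave_transform_def fun_eq_iff h'_def psi_hat_def zero_less_mult_iff
      intro!: Bochner_Integration.integral_cong)
  ultimately show "F \<in> wave_transform k ` L2plus"
    using wavelet_coeff_eq_wave_transform[OF psi f] F by auto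
next
  fix F assume "F \<in> wave_transform k ` L2plus"
  then obtain h where h: "h \<in> L2plus" "F = wave_transform k h" by auto
  obtain f where f: "is_fourier f h"
    using fourier_inverse_exists h(1) by (auto simp: L2plus_def)
  have "f \<in> H2plus" using f h(1) by (auto simp: H2plus_def L2plus_def is_fourier_def)
  then show "F \<in> wavelet_space psi"
    using wavelet_coeff_eq_wave_transform[OF psi f, symmetric] h(2) by (auto simp: wavelet_space_def)
qed

section \<open>Laguerre functions\<close>

text \<open>Pascal's rule, read as: a finite difference of order \<open>Suc k\<close> is a
  difference of two of order \<open>k\<close>.\<close>

lemma alternating_binomial_sum_Suc:
  fixes f :: "nat \<Rightarrow> real"
  shows "(\<Sum>i\<le>Suc k. (-1)^i * real (Suc k choose i) * f i)
    = (\<Sum>i\<le>k. (-1)^i * real (k choose i) * f i) - (\<Sum>i\<le>k. (-1)^i * real (k choose i) * f (Suc i))"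
proof -
  have "(\<Sum>i\<le>Suc k. (-1)^i * real (Suc k choose i) * f i)
      = f 0 + (\<Sum>i\<le>k. (-1)^(Suc i) * real (Suc k choose Suc i) * f (Suc i))"
    by (subst sum.atMost_Suc_shift) simp
  also have "\<dots> = (f 0 + (\<Sum>i\<le>k. (-1)^(Suc i) * real (k choose Suc i) * f (Suc i)))
      - (\<Sum>i\<le>k. (-1)^i * real (k choose i) * f (Suc i))"
    by (simp add: sum.distrib[symmetric] sum_subtractf[symmetric] algebra_simps sum_negf)
  also have "f 0 + (\<Sum>i\<le>k. (-1)^(Suc i) * real (k choose Suc i) * f (Suc i))
      = (\<Sum>i\<le>Suc k. (-1)^i * real (k choose i) * f i)"
    by (subst sum.atMost_Suc_shift) simp
  finally show ?thesis by simp
qed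

text \<open>Each difference lowers the lower index of the binomial coefficient by one. The shift
  \<open>n\<close> stays general because the induction step produces \<open>Suc n\<close>.\<close>

lemma alternating_binomial_sum:
  "(\<Sum>i\<le>k. (-1)^i * real (k choose i) * real ((n + i) choose m))
    = (if k \<le> m then (-1)^k * real (n choose (m - k)) else 0)"
proof (induction k arbitrary: n)
  case (Suc k)
  have "(\<Sum>i\<le>Suc k. (-1)^i * real (Suc k choose i) * real ((n + i) choose m))
     = (\<Sum>i\<le>k. (-1)^i * real (k choose i) * real ((n + i) choose m))
       - (\<Sum>i\<le>k. (-1)^i * real (k choose i) * real ((Suc n + i) choose m))"
    by (subst alternating_binomial_sum_Suc) simp
  also have "\<dots> = (if k \<le> m then (-1)^k * real (n choose (m - k)) else 0)
       - (if k \<le> m then (-1)^k * real (Suc n choose (m - k)) else 0)"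
    unfolding Suc ..
  also have "\<dots> = (if Suc k \<le> m then (-1)^Suc k * real (n choose (m - Suc k)) else 0)"
  proof (cases "Suc k \<le> m")
    case True
    then have "m - k = Suc (m - Suc k)" by simp
    with True show ?thesis by (simp add: algebra_simps)
  qed (auto simp: le_less Suc_le_eq)
  finally show ?case .
qed simp

text \<open>Termwise integration gives \<open>fact (m + i)\<close>, and its quotient by
  \<open>fact i\<close> is \<open>fact m\<close> times a binomial coefficient; the moment is thus a
  finite difference of order \<open>k\<close>. For \<open>m < k\<close> this is the orthogonality to
  lower powers.\<close>

lemma laguerre_moment:
  "has_bochner_integral lborel (\<lambda>x. x^m * exp (-x) * laguerre k x * indicator {0<..} x)
     (fact m * (if k \<le> m then (-1)^k * real (m choose k) else 0))"
proof -
  have "has_bochner_integral lborel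
     (\<lambda>x. \<Sum>i\<le>k. ((-1)^i * real (k choose i) / fact i) * (x^(m + i) * exp (-x) * indicator {0<..} x))
     (\<Sum>i\<le>k. ((-1)^i * real (k choose i) / fact i) * fact (m + i))"
    by (intro has_bochner_integral_sum has_bochner_integral_mult_right has_bochner_integral_I0i_power_exp_m)
  also have "(\<lambda>x. \<Sum>i\<le>k. ((-1)^i * real (k choose i) / fact i) * (x^(m + i) * exp (-x) * indicator {0<..} x))
      = (\<lambda>x. x^m * exp (-x) * laguerre k x * indicator {0<..} x)"
    by (auto simp: laguerre_def sum_distrib_left sum_distrib_right power_add intro!: sum.cong)
  also have "(\<Sum>i\<le>k. ((-1)^i * real (k choose i) / fact i) * fact (m + i))
      = (\<Sum>i\<le>k. fact m * ((-1)^i * real (k choose i) * real ((m + i) choose m)))"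
    by (intro sum.cong refl) (simp add: binomial_fact)
  also have "\<dots> = fact m * (if k \<le> m then (-1)^k * real (m choose k) else 0)"
    unfolding sum_distrib_left[symmetric] alternating_binomial_sum
    by (auto simp: binomial_symmetric[symmetric])
  finally show ?thesis .
qed

text \<open>When one Laguerre factor is expanded, only its leading term survives: coefficient
  \<open>(-1)^k / fact k\<close> against moment \<open>(-1)^k * fact k\<close>.\<close>

lemma lfun_square_integral:
  "has_bochner_integral lborel (\<lambda>x. (lfun k x)^2 * indicator {0<..} x) 1"
proof -
  let ?c = "\<lambda>m. (-1)^m * real (k choose m) / fact m :: real"
  have "has_bochner_integral lborel
     (\<lambda>x. \<Sum>m\<le>k. ?c m * (x^m * exp (-x) * laguerre k x * indicator {0<..} x))
     (\<Sum>m\<le>k. ?c m * (fact m * (if k \<le> m then (-1)^k * real (m choose k) else 0)))"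
    by (intro has_bochner_integral_sum has_bochner_integral_mult_right laguerre_moment)
  also have "(\<Sum>m\<le>k. ?c m * (fact m * (if k \<le> m then (-1)^k * real (m choose k) else 0)))
      = (\<Sum>m\<le>k. if m = k then 1 else 0)"
    by (intro sum.cong refl) (auto simp flip: power_mult_distrib)
  also have "\<dots> = 1" by simp
  also have "(\<lambda>x. \<Sum>m\<le>k. ?c m * (x^m * exp (-x) * laguerre k x * indicator {0<..} x))
      = (\<lambda>x. (lfun k x)^2 * indicator {0<..} x)"
  proof
    fix x :: real
    have e: "(exp (- x / 2))^2 = exp (- x)" by (simp flip: exp_of_nat_mult)
    have "(lfun k x)^2 = exp (- x) * (laguerre k x * laguerre k x)"
      unfolding lfun_def power_mult_distrib e by (simp add: power2_eq_square)
    also have "\<dots> = exp (- x) * ((\<Sum>m\<le>k. ?c m * x^m) * laguerre k x)"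
      by (simp add: laguerre_def)
    finally show "(\<Sum>m\<le>k. ?c m * (x^m * exp (-x) * laguerre k x * indicator {0<..} x)) = (lfun k x)^2 * indicator {0<..} x"
      by (simp add: sum_distrib_left sum_distrib_right mult_ac)
  qed
  finally show ?thesis .
qed

section \<open>Toeplitz forms of the wavelet transform\<close>

definition psir :: "nat \<Rightarrow> real \<Rightarrow> real" where
  "psir k \<xi> = (if \<xi> > 0 then sqrt (2 * \<xi>) * lfun k (2 * \<xi>) else 0)"

lemma psi_hat_eq_psir: "psi_hat k \<xi> = of_real (psir k \<xi>)"
  by (simp add: psi_hat_def psir_def)

lemma laguerre_measurable[measurable]: "laguerre k \<in> borel_measurable borel"
  unfolding laguerre_def[abs_def] by measurable

lemma lfun_measurable[measurable]: "lfun k \<in> borel_measurable borel"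
  unfolding lfun_def[abs_def] by measurable

lemma psir_measurable[measurable]: "psir k \<in> borel_measurable borel"
  unfolding psir_def[abs_def] by measurable

section \<open>Boundedness of the transformed wavelet\<close>

lemma power_le_fact_exp:
  fixes x :: real
  assumes "x \<ge> 0"
  shows "x ^ n \<le> fact n * exp x"
proof -
  have "(\<Sum>i\<in>{n}. x ^ i /\<^sub>R fact i) \<le> (\<Sum>i. x ^ i /\<^sub>R fact i)"
    by (rule sum_le_suminf[OF summable_exp_generic]) (use assms in auto)
  then show ?thesis by (simp add: exp_def field_simps)
qed

text \<open>Powers of \<open>x / 2\<close> are at most a factorial times \<open>exp (x / 2)\<close>,
  which the exponential factor cancels; replacing \<open>sqrt x\<close> by \<open>1 + x\<close>
  causes the second term.\<close>

lemma sqrt_exp_power_le: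
  fixes x :: real
  assumes x: "x \<ge> 0"
  shows "sqrt x * exp (- x / 2) * x ^ i \<le> 2 ^ i * fact i + 2 ^ Suc i * fact (Suc i)"
proof -
  have "sqrt x \<le> 1 + x"
    by (rule real_le_lsqrt) (use x in \<open>auto simp: power2_eq_square algebra_simps\<close>)
  then have "sqrt x * exp (- x / 2) * x ^ i \<le> (1 + x) * exp (- x / 2) * x ^ i"
    using x by (intro mult_right_mono) auto
  also have "\<dots> = exp (- x / 2) * (2 ^ i * (x / 2) ^ i + 2 ^ Suc i * (x / 2) ^ Suc i)"
    by (simp add: power_divide algebra_simps)
  also have "\<dots> \<le> exp (- x / 2) * (2 ^ i * (fact i * exp (x / 2)) + 2 ^ Suc i * (fact (Suc i) * exp (x / 2)))"
    using x by (intro mult_left_mono add_mono power_le_fact_exp) auto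
  also have "\<dots> = (2 ^ i * fact i + 2 ^ Suc i * fact (Suc i)) * (exp (- x / 2) * exp (x / 2))"
    by (simp only: distrib_left distrib_right mult_ac)
  also have "exp (- x / 2) * exp (x / 2) = 1" by (simp flip: exp_add)
  finally show ?thesis by simp
qed

text \<open>A bounded multiplier keeps square-integrable functions square-integrable. The constant
  comes from the triangle inequality over the terms of the Laguerre polynomial.\<close>

lemma psir_bounded: "\<exists>C. \<forall>\<xi>. \<bar>psir k \<xi>\<bar> \<le> C"
proof (intro exI allI)
  fix \<xi> :: real
  let ?D = "\<lambda>i. 2 ^ i * fact i + 2 ^ Suc i * fact (Suc i) :: real"
  let ?C = "\<Sum>i\<le>k. real (k choose i) / fact i * ?D i"
  show "\<bar>psir k \<xi>\<bar> \<le> ?C"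
  proof (cases "\<xi> > 0")
    case True
    let ?x = "2 * \<xi>"
    have "\<bar>psir k \<xi>\<bar> = \<bar>\<Sum>i\<le>k. sqrt ?x * exp (- ?x / 2) * ((-1)^i * real (k choose i) * ?x^i / fact i)\<bar>"
      using True by (simp add: psir_def lfun_def laguerre_def sum_distrib_left mult.assoc)
    also have "\<dots> \<le> (\<Sum>i\<le>k. \<bar>sqrt ?x * exp (- ?x / 2) * ((-1)^i * real (k choose i) * ?x^i / fact i)\<bar>)"
      by (rule sum_abs)
    also have "\<dots> = (\<Sum>i\<le>k. real (k choose i) / fact i * (sqrt ?x * exp (- ?x / 2) * ?x^i))"
      using True by (intro sum.cong refl) (simp add: abs_mult power_abs abs_divide)
    also have "\<dots> \<le> ?C"
      by (intro sum_mono mult_left_mono sqrt_exp_power_le) (use True in auto)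
    finally show ?thesis .
  next
    case False
    then show ?thesis by (auto simp: psir_def intro!: sum_nonneg)
  qed
qed

text \<open>The weight that remains once \<open>u\<close> has been integrated out by Plancherel; as a function of \<open>v\<close> it
  has total mass 1 for every positive \<open>\<xi>\<close>, by the normalisation of the Laguerre functions.\<close>

definition kern :: "nat \<Rightarrow> real \<Rightarrow> real \<Rightarrow> real" where
  "kern k \<xi> v = (if v > 0 then (psir k (v * \<xi>))^2 / v else 0)"

lemma kern_nonneg: "0 \<le> kern k \<xi> v"
  by (simp add: kern_def)

text \<open>The \<open>v\<close> from the squared root cancels the denominator, leaving the squared
  Laguerre function at \<open>2 * \<xi> * v\<close> with the matching Jacobian
  \<open>2 * \<xi>\<close>.\<close>

lemma kern_pos_eq:
  assumes "\<xi> > 0"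
  shows "kern k \<xi> v = 2 * \<xi> * ((lfun k (2 * \<xi> * v))^2 * indicator {0<..} (2 * \<xi> * v))"
  using assms by (auto simp: kern_def psir_def power_mult_distrib zero_less_mult_iff indicator_def mult_ac)

lemma kern_nonpos: "\<xi> \<le> 0 \<Longrightarrow> kern k \<xi> v = 0"
  by (auto simp: kern_def psir_def zero_less_mult_iff)

lemma kern_integral:
  assumes \<xi>: "\<xi> > 0"
  shows "integrable lborel (kern k \<xi>)" "(LINT v|lborel. kern k \<xi> v) = 1"
proof -
  let ?f = "\<lambda>x. (lfun k x)^2 * indicator {0<..} x :: real"
  have i: "integrable lborel ?f" "(LINT x|lborel. ?f x) = 1"
    using lfun_square_integral[of k] by (auto simp: has_bochner_integral_iff)
  show "integrable lborel (kern k \<xi>)"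
    unfolding kern_pos_eq[OF \<xi>, abs_def]
    using lborel_integrable_real_affine[OF i(1), of "2 * \<xi>" 0] \<xi> by simp
  have "(LINT v|lborel. kern k \<xi> v) = \<bar>2 * \<xi>\<bar> *\<^sub>R (LINT v|lborel. ?f (0 + 2 * \<xi> * v))"
    unfolding kern_pos_eq[OF \<xi>] using \<xi> by simp
  also have "\<dots> = 1"
    using lborel_integral_real_affine[of "2 * \<xi>" ?f 0] \<xi> i(2) by simp
  finally show "(LINT v|lborel. kern k \<xi> v) = 1" .
qed

text \<open>Rescaling by \<open>2 * \<xi>\<close> moves the dilation from the symbol to the Laguerre
  function.\<close>

lemma gamma_ak_eq_kern:
  fixes a :: "real \<Rightarrow> complex"
  assumes \<xi>: "\<xi> > 0"
  shows "gamma_ak a k \<xi> = (LINT v|lborel. a v * of_real (kern k \<xi> v))"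
proof -
  let ?f = "\<lambda>t. indicator {0<..} t *\<^sub>R (a (t / (2 * \<xi>)) * complex_of_real ((lfun k t)^2))"
  have "gamma_ak a k \<xi> = (LINT t|lborel. ?f t)"
    unfolding gamma_ak_def set_lebesgue_integral_def ..
  also have "\<dots> = \<bar>2 * \<xi>\<bar> *\<^sub>R (LINT v|lborel. ?f (0 + 2 * \<xi> * v))"
    by (rule lborel_integral_real_affine) (use \<xi> in simp)
  also have "\<dots> = (LINT v|lborel. \<bar>2 * \<xi>\<bar> *\<^sub>R ?f (0 + 2 * \<xi> * v))"
    unfolding scaleR_conv_of_real[of "\<bar>2 * \<xi>\<bar>"] by (rule integral_mult_right_zero[symmetric])
  also have "\<dots> = (LINT v|lborel. a v * of_real (kern k \<xi> v))"
    using \<xi> by (intro Bochner_Integration.integral_cong)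
      (auto simp: kern_pos_eq indicator_def scaleR_conv_of_real zero_less_mult_iff)
  finally show ?thesis .
qed

text \<open>Integrating in \<open>v\<close> first leaves the squared modulus of \<open>h\<close> on
  the positive axis, since the weight has mass 1 there. The later exchanges of integrals rest on
  this function.\<close>

lemma kern_weight_integrable:
  assumes h: "L2 lborel h"
  shows "integrable (lborel \<Otimes>\<^sub>M lborel) (\<lambda>(\<xi>, v). kern k \<xi> v * (cmod (h \<xi>))^2)"
proof -
  have [measurable]: "h \<in> borel_measurable lborel" using h by (simp add: L2_def)
  have i: "integrable lborel (kern k \<xi>)" for \<xi>
  proof (cases "\<xi> > 0")
    case False
    then have "kern k \<xi> = (\<lambda>_. 0)" by (intro ext kern_nonpos) simp
    then show ?thesis by simp
  qed (rule kern_integral)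
  have I: "(LINT v|lborel. kern k \<xi> v) = indicator {0<..} \<xi>" for \<xi>
    by (cases "\<xi> > 0") (simp_all add: kern_integral kern_nonpos)
  show ?thesis
  proof (rule lborel_pair.Fubini_integrable)
    show "(\<lambda>(\<xi>, v). kern k \<xi> v * (cmod (h \<xi>))\<^sup>2) \<in> borel_measurable (lborel \<Otimes>\<^sub>M lborel)"
      unfolding kern_def by measurable
    have "integrable lborel (\<lambda>x. indicator {0<..} x * (cmod (h x))\<^sup>2)"
      by (rule Bochner_Integration.integrable_bound[OF L2_integrable[OF h]]) (auto simp: indicator_def)
    then show "integrable lborel (\<lambda>x. LINT y|lborel. norm (case (x, y) of (\<xi>, v) \<Rightarrow> kern k \<xi> v * (cmod (h \<xi>))\<^sup>2))"
      by (simp add: abs_mult kern_nonneg I)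
    show "AE x in lborel. integrable lborel (\<lambda>y. case (x, y) of (\<xi>, v) \<Rightarrow> kern k \<xi> v * (cmod (h \<xi>))\<^sup>2)"
      by (simp add: i)
  qed
qed

text \<open>For fixed \<open>v\<close> the wavelet transform is, in \<open>u\<close>, the reflected Fourier transform of this function.\<close>

definition dilated :: "nat \<Rightarrow> real \<Rightarrow> (real \<Rightarrow> complex) \<Rightarrow> real \<Rightarrow> complex" where
  "dilated k v h \<xi> = of_real (sqrt v * psir k (v * \<xi>)) * h \<xi>"

lemma wave_transform_eq_FT:
  assumes "v > 0"
  shows "wave_transform k h (u, v) = FT (dilated k v h) (0 + (-1) * u)"
  using assms unfolding wave_transform_def FT_def
  by (auto simp: dilated_def psi_hat_eq_psir cis_cnj mult_ac intro!: Bochner_Integration.integral_cong)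

text \<open>Square-integrable because \<open>psir k\<close> is bounded, integrable because both
  factors are square-integrable; Plancherel in \<open>u\<close> uses both.\<close>

lemma dilated_L1_L2:
  assumes psi: "L2 lborel (psi_hat k)" and h: "L2 lborel h" and v: "v > 0"
  shows "integrable lborel (dilated k v h)" "L2 lborel (dilated k v h)"
proof -
  obtain C where C: "\<And>\<xi>. \<bar>psir k \<xi>\<bar> \<le> C" using psir_bounded by blast
  show "L2 lborel (dilated k v h)"
    unfolding dilated_def[abs_def]
    by (rule L2_bounded_mult[OF h, where B="sqrt v * C"])
       (use v C in \<open>auto simp: abs_mult norm_mult intro!: mult_left_mono\<close>)
  have "L2 lborel (\<lambda>\<xi>. psi_hat k (0 + v * \<xi>))"
    by (rule L2_affine[OF psi]) (use v in simp)
  from L2_mult_integrable[OF L2_scale[OF this] h, of "of_real (sqrt v)"]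
  show "integrable lborel (dilated k v h)"
    by (simp add: dilated_def[abs_def] psi_hat_eq_psir)
qed

lemma wave_transform_slice:
  assumes psi: "L2 lborel (psi_hat k)" and h: "L2 lborel h" "L2 lborel h'" and v: "v > 0"
  shows "L2 lborel (\<lambda>u. wave_transform k h (u, v))"
    and "(LINT u|lborel. (cmod (wave_transform k h (u, v)))^2) = v^2 * (LINT \<xi>|lborel. kern k \<xi> v * (cmod (h \<xi>))^2)"
    and "(LINT u|lborel. wave_transform k h (u, v) * cnj (wave_transform k h' (u, v)))
      = of_real (v^2) * (LINT \<xi>|lborel. of_real (kern k \<xi> v) * (h \<xi> * cnj (h' \<xi>)))"
proof -
  note d = dilated_L1_L2[OF psi h(1) v] and d' = dilated_L1_L2[OF psi h(2) v]
  note P = Plancherel[OF d]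
  show "L2 lborel (\<lambda>u. wave_transform k h (u, v))"
    unfolding wave_transform_eq_FT[OF v] by (rule L2_affine[OF P(1)]) simp
  \<comment> \<open>One \<open>v\<close> is the square of \<open>sqrt v\<close>, the other clears
    the denominator of \<open>kern\<close>; together they will cancel the density of
    \<open>nuG\<close>.\<close>
  have kv: "(sqrt v * psir k (v * \<xi>))^2 = v^2 * kern k \<xi> v" for \<xi>
    using v by (simp add: kern_def power_mult_distrib power2_eq_square)
  have "(LINT u|lborel. (cmod (wave_transform k h (u, v)))^2) = sqn lborel (dilated k v h)"
    unfolding wave_transform_eq_FT[OF v]
    using L2_affine(2)[OF P(1), of "-1" 0] P(2) by (simp add: sqn_def)
  also have "\<dots> = (LINT \<xi>|lborel. v^2 * (kern k \<xi> v * (cmod (h \<xi>))^2))"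
    unfolding sqn_def dilated_def norm_mult power_mult_distrib norm_of_real power2_abs
    unfolding power_mult_distrib[symmetric] kv by (simp add: mult.assoc)
  finally show "(LINT u|lborel. (cmod (wave_transform k h (u, v)))^2) = v^2 * (LINT \<xi>|lborel. kern k \<xi> v * (cmod (h \<xi>))^2)"
    by simp
  have "(LINT u|lborel. wave_transform k h (u, v) * cnj (wave_transform k h' (u, v)))
     = L2inner lborel (FT (dilated k v h)) (FT (dilated k v h'))"
    unfolding wave_transform_eq_FT[OF v] L2inner_def
    by (subst (2) lborel_integral_real_affine[of "-1" _ 0]) simp_all
  also have "\<dots> = L2inner lborel (dilated k v h) (dilated k v h')"
    by (rule Parseval[OF d d'])
  also have "\<dots> = (LINT \<xi>|lborel. of_real (v^2) * (of_real (kern k \<xi> v) * (h \<xi> * cnj (h' \<xi>))))"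
    unfolding L2inner_def
  proof (intro Bochner_Integration.integral_cong refl)
    fix \<xi>
    have "dilated k v h \<xi> * cnj (dilated k v h' \<xi>) = of_real ((sqrt v * psir k (v * \<xi>))^2) * (h \<xi> * cnj (h' \<xi>))"
      by (simp add: dilated_def power2_eq_square mult_ac)
    then show "dilated k v h \<xi> * cnj (dilated k v h' \<xi>) = of_real (v^2) * (of_real (kern k \<xi> v) * (h \<xi> * cnj (h' \<xi>)))"
      unfolding kv by simp
  qed
  finally show "(LINT u|lborel. wave_transform k h (u, v) * cnj (wave_transform k h' (u, v)))
      = of_real (v^2) * (LINT \<xi>|lborel. of_real (kern k \<xi> v) * (h \<xi> * cnj (h' \<xi>)))"
    by simp
qed


lemma wave_transform_measurable[measurable]:
  assumes [measurable]: "h \<in> borel_measurable lborel"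
  shows "wave_transform k h \<in> borel_measurable (lborel \<Otimes>\<^sub>M lborel)"
  unfolding wave_transform_def[abs_def] psi_hat_eq_psir by measurable

definition nu_density :: "real \<times> real \<Rightarrow> real" where
  "nu_density p = (if snd p > 0 then 1 / (snd p)^2 else 0)"

lemma nu_density_measurable[measurable]: "nu_density \<in> borel_measurable (borel \<Otimes>\<^sub>M borel)"
  unfolding nu_density_def[abs_def] by measurable

lemma nu_density_nonneg: "0 \<le> nu_density p"
  by (simp add: nu_density_def)

lemma nuG_eq: "nuG = density (lborel \<Otimes>\<^sub>M lborel) (\<lambda>p. ennreal (nu_density p))"
  unfolding nuG_def nu_density_def lborel_prod[symmetric] by (simp add: if_distrib cong: if_cong)

section \<open>The sesquilinear form of a bounded symbol\<close>

context
  fixes k :: nat and a h h' :: "real \<Rightarrow> complex" and C :: real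
  assumes psi: "L2 lborel (psi_hat k)" and h: "L2 lborel h" and h': "L2 lborel h'"
    and a: "a \<in> borel_measurable lborel" "\<And>v. cmod (a v) \<le> C"
begin

text \<open>The density of \<open>nuG\<close> is absorbed into the integrand, so that Fubini applies
  to Lebesgue measure on the plane.\<close>

definition slice :: "real \<Rightarrow> real \<Rightarrow> complex" where
  "slice u v = nu_density (u, v) *\<^sub>R (a v * wave_transform k h (u, v) * cnj (wave_transform k h' (u, v)))"

lemma [measurable]: "h \<in> borel_measurable lborel" "h' \<in> borel_measurable lborel" "a \<in> borel_measurable lborel"
  using h h' a by (auto simp: L2_def)

lemma slice_measurable[measurable]: "(\<lambda>(u, v). slice u v) \<in> borel_measurable (lborel \<Otimes>\<^sub>M lborel)"
  unfolding slice_def by measurable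

lemma slice_measurable'[measurable]: "(\<lambda>(v, u). slice u v) \<in> borel_measurable (lborel \<Otimes>\<^sub>M lborel)"
  unfolding slice_def by measurable

lemma C_nonneg: "C \<ge> 0"
  using a(2)[of 0] norm_ge_zero order_trans by blast

lemma slice_nonpos: "v \<le> 0 \<Longrightarrow> slice u v = 0"
  by (simp add: slice_def nu_density_def)

lemma slice_pos: "v > 0 \<Longrightarrow> slice u v =
    (of_real (1 / v^2) * a v) * (wave_transform k h (u, v) * cnj (wave_transform k h' (u, v)))"
  by (simp add: slice_def nu_density_def scaleR_conv_of_real)

lemma slice_integrable_u: "integrable lborel (\<lambda>u. slice u v)"
proof (cases "v > 0")
  case True
  show ?thesis unfolding slice_pos[OF True]
    by (intro integrable_mult_right L2inner_integrable wave_transform_slice(1)[OF psi h h' True] wave_transform_slice(1)[OF psi h' h True])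
qed (simp add: slice_nonpos)

lemma kern_weight_snd_integrable:
  "L2 lborel g \<Longrightarrow> integrable lborel (\<lambda>v. LINT \<xi>|lborel. kern k \<xi> v * (cmod (g \<xi>))^2)"
  by (rule lborel_pair.integrable_snd[OF kern_weight_integrable])

text \<open>Bounding a product by half the sum of squares splits the mixed term into two diagonal
  ones, which Plancherel evaluates on the slice.\<close>

lemma norm_slice_integral_le:
  "(LINT u|lborel. cmod (slice u v)) \<le>
     C / 2 * ((LINT \<xi>|lborel. kern k \<xi> v * (cmod (h \<xi>))^2) + (LINT \<xi>|lborel. kern k \<xi> v * (cmod (h' \<xi>))^2))"
proof (cases "v > 0")
  case v: True
  note s = wave_transform_slice[OF psi h h' v] and s' = wave_transform_slice[OF psi h' h v]
  have "(LINT u|lborel. cmod (slice u v)) \<le> (LINT u|lborel. C / (2 * v^2) * ((cmod (wave_transform k h (u, v)))^2 + (cmod (wave_transform k h' (u, v)))^2))"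
  proof (rule integral_mono)
    show "integrable lborel (\<lambda>u. cmod (slice u v))" using slice_integrable_u by simp
    show "integrable lborel (\<lambda>u. C / (2 * v^2) * ((cmod (wave_transform k h (u, v)))^2 + (cmod (wave_transform k h' (u, v)))^2))"
      using s(1) s'(1) by (intro integrable_mult_right Bochner_Integration.integrable_add) (simp_all add: L2_def)
    fix u
    let ?x = "cmod (wave_transform k h (u, v))" and ?y = "cmod (wave_transform k h' (u, v))"
    have "cmod (slice u v) = 1 / v^2 * (cmod (a v) * (?x * ?y))"
      by (simp add: slice_pos[OF v] norm_mult norm_divide norm_power)
    also have "\<dots> \<le> 1 / v^2 * (C * ((?x^2 + ?y^2) / 2))"
      by (intro mult_left_mono mult_mono a cmod_mult_le) (auto simp: C_nonneg)
    also have "\<dots> = C / (2 * v^2) * (?x^2 + ?y^2)" by (simp add: mult_ac)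
    finally show "cmod (slice u v) \<le> C / (2 * v^2) * (?x^2 + ?y^2)" .
  qed
  also have "\<dots> = C / (2 * v^2) * ((LINT u|lborel. (cmod (wave_transform k h (u, v)))^2) + (LINT u|lborel. (cmod (wave_transform k h' (u, v)))^2))"
    using s(1) s'(1) by (simp add: L2_def)
  also have "\<dots> = C / 2 * ((LINT \<xi>|lborel. kern k \<xi> v * (cmod (h \<xi>))^2) + (LINT \<xi>|lborel. kern k \<xi> v * (cmod (h' \<xi>))^2))"
    unfolding s(2) s'(2) using v by (simp add: field_simps)
  finally show ?thesis .
next
  case False
  then show ?thesis by (simp add: slice_nonpos kern_def)
qed

text \<open>The integral over \<open>u\<close> has to be the inner one, since that is where
  Plancherel gives control; the pair is swapped back at the end.\<close>

lemma slice_integrable: "integrable (lborel \<Otimes>\<^sub>M lborel) (\<lambda>(u, v). slice u v)"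
proof -
  have "integrable (lborel \<Otimes>\<^sub>M lborel) (\<lambda>(v, u). slice u v)"
  proof (rule lborel_pair.Fubini_integrable)
    show "integrable lborel (\<lambda>v. LINT u|lborel. norm (case (v, u) of (v, u) \<Rightarrow> slice u v))"
    proof (rule Bochner_Integration.integrable_bound)
      show "integrable lborel (\<lambda>v. C / 2 * ((LINT \<xi>|lborel. kern k \<xi> v * (cmod (h \<xi>))^2) + (LINT \<xi>|lborel. kern k \<xi> v * (cmod (h' \<xi>))^2)))"
        by (intro integrable_mult_right Bochner_Integration.integrable_add kern_weight_snd_integrable h h')
      show "AE v in lborel. norm (LINT u|lborel. norm (case (v, u) of (v, u) \<Rightarrow> slice u v)) \<le>
        norm (C / 2 * ((LINT \<xi>|lborel. kern k \<xi> v * (cmod (h \<xi>))^2) + (LINT \<xi>|lborel. kern k \<xi> v * (cmod (h' \<xi>))^2)))"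
      proof (rule AE_I2)
        fix v
        have "norm (LINT u|lborel. norm (case (v, u) of (v, u) \<Rightarrow> slice u v)) = (LINT u|lborel. cmod (slice u v))"
          by simp
        also note norm_slice_integral_le
        also note abs_ge_self
        finally show "norm (LINT u|lborel. norm (case (v, u) of (v, u) \<Rightarrow> slice u v)) \<le>
          norm (C / 2 * ((LINT \<xi>|lborel. kern k \<xi> v * (cmod (h \<xi>))^2) + (LINT \<xi>|lborel. kern k \<xi> v * (cmod (h' \<xi>))^2)))"
          unfolding real_norm_def .
      qed
    qed measurable
    show "AE v in lborel. integrable lborel (\<lambda>u. case (v, u) of (v, u) \<Rightarrow> slice u v)"
      using slice_integrable_u by simp
  qed measurable
  from lborel_pair.integrable_product_swap[OF this] show ?thesis
    by (simp add: case_prod_beta')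
qed

text \<open>Exchanging \<open>\<xi>\<close> and \<open>v\<close> is a second use of Fubini, with a
  different integrand; the same splitting reduces it to the diagonal weights.\<close>

lemma kern_pair_integrable:
  "integrable (lborel \<Otimes>\<^sub>M lborel) (\<lambda>(\<xi>, v). a v * (of_real (kern k \<xi> v) * (h \<xi> * cnj (h' \<xi>))))"
proof (rule Bochner_Integration.integrable_bound)
  show "integrable (lborel \<Otimes>\<^sub>M lborel) (\<lambda>p. C / 2 * ((case p of (\<xi>, v) \<Rightarrow> kern k \<xi> v * (cmod (h \<xi>))^2) + (case p of (\<xi>, v) \<Rightarrow> kern k \<xi> v * (cmod (h' \<xi>))^2)))"
    by (intro integrable_mult_right Bochner_Integration.integrable_add kern_weight_integrable h h')
  show "(\<lambda>(\<xi>, v). a v * (of_real (kern k \<xi> v) * (h \<xi> * cnj (h' \<xi>)))) \<in> borel_measurable (lborel \<Otimes>\<^sub>M lborel)"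
    unfolding kern_def by measurable
  have "cmod (a v * (of_real (kern k \<xi> v) * (h \<xi> * cnj (h' \<xi>))))
     \<le> C / 2 * (kern k \<xi> v * (cmod (h \<xi>))^2 + kern k \<xi> v * (cmod (h' \<xi>))^2)" for \<xi> v
  proof -
    have "cmod (a v * (of_real (kern k \<xi> v) * (h \<xi> * cnj (h' \<xi>)))) = cmod (a v) * (kern k \<xi> v * (cmod (h \<xi>) * cmod (h' \<xi>)))"
      by (simp add: norm_mult kern_nonneg)
    also have "\<dots> \<le> C * (kern k \<xi> v * (((cmod (h \<xi>))^2 + (cmod (h' \<xi>))^2) / 2))"
      by (intro mult_mono mult_left_mono a cmod_mult_le mult_nonneg_nonneg) (auto simp: C_nonneg kern_nonneg)
    finally show ?thesis by (simp add: algebra_simps)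
  qed
  then show "AE p in lborel \<Otimes>\<^sub>M lborel. norm (case p of (\<xi>, v) \<Rightarrow> a v * (of_real (kern k \<xi> v) * (h \<xi> * cnj (h' \<xi>))))
     \<le> norm (C / 2 * ((case p of (\<xi>, v) \<Rightarrow> kern k \<xi> v * (cmod (h \<xi>))^2) + (case p of (\<xi>, v) \<Rightarrow> kern k \<xi> v * (cmod (h' \<xi>))^2)))"
    by (intro AE_I2) (auto simp: case_prod_beta' intro: order_trans[OF _ abs_ge_self])
qed

lemma slice_integral_u:
  "(LINT u|lborel. slice u v) = (LINT \<xi>|lborel. a v * (of_real (kern k \<xi> v) * (h \<xi> * cnj (h' \<xi>))))"
proof (cases "v > 0")
  case v: True
  show ?thesis
    unfolding slice_pos[OF v] integral_mult_right_zero wave_transform_slice(3)[OF psi h h' v]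
    using v by simp
qed (simp add: slice_nonpos kern_def)

lemma integrable_toeplitz_form:
  "integrable nuG (\<lambda>p. a (snd p) * wave_transform k h p * cnj (wave_transform k h' p))"
  unfolding nuG_eq using slice_integrable
  by (subst integrable_density) (auto simp: slice_def case_prod_beta' nu_density_nonneg)

text \<open>Off the positive axis \<open>kern\<close> vanishes but \<open>gamma_ak\<close> need not;
  the integrands agree there because \<open>h\<close> is 0.\<close>

lemma toeplitz_form:
  assumes h0: "\<And>\<xi>. \<xi> \<le> 0 \<Longrightarrow> h \<xi> = 0"
  shows "L2inner nuG (\<lambda>p. a (snd p) * wave_transform k h p) (wave_transform k h')
    = (LINT \<xi>|lborel. gamma_ak a k \<xi> * h \<xi> * cnj (h' \<xi>))"
proof -
  have "L2inner nuG (\<lambda>p. a (snd p) * wave_transform k h p) (wave_transform k h')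
      = integral\<^sup>L (lborel \<Otimes>\<^sub>M lborel) (\<lambda>(u, v). slice u v)"
    unfolding L2inner_def nuG_eq
    by (subst integral_density) (auto simp: slice_def case_prod_beta' nu_density_nonneg)
  also have "\<dots> = (LINT v|lborel. LINT u|lborel. slice u v)"
    by (rule lborel_pair.integral_snd[OF slice_integrable, symmetric])
  also have "\<dots> = (LINT \<xi>|lborel. LINT v|lborel. a v * (of_real (kern k \<xi> v) * (h \<xi> * cnj (h' \<xi>))))"
    unfolding slice_integral_u by (rule lborel_pair.Fubini_integral[OF kern_pair_integrable])
  also have "\<dots> = (LINT \<xi>|lborel. gamma_ak a k \<xi> * h \<xi> * cnj (h' \<xi>))"
  proof (rule Bochner_Integration.integral_cong)
    fix \<xi>
    show "(LINT v|lborel. a v * (of_real (kern k \<xi> v) * (h \<xi> * cnj (h' \<xi>)))) = gamma_ak a k \<xi> * h \<xi> * cnj (h' \<xi>)"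
    proof (cases "\<xi> > 0")
      case True
      have "(LINT v|lborel. a v * (of_real (kern k \<xi> v) * (h \<xi> * cnj (h' \<xi>))))
        = (LINT v|lborel. (a v * of_real (kern k \<xi> v)) * (h \<xi> * cnj (h' \<xi>)))"
        by (simp add: mult.assoc)
      then show ?thesis by (simp add: gamma_ak_eq_kern[OF True])
    qed (simp add: h0)
  qed simp
  finally show ?thesis .
qed

end

section \<open>The unitary equivalence\<close>

lemma wave_transform_add_scale:
  assumes psi: "L2 lborel (psi_hat k)" and h: "L2 lborel h" "L2 lborel h'"
  shows "wave_transform k (\<lambda>\<xi>. h \<xi> + c * h' \<xi>) p = wave_transform k h p + c * wave_transform k h' p"
proof (cases "snd p > 0")
  case True
  obtain u v where p: "p = (u, v)" by (cases p)
  with True have v: "v > 0" by simp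
  have "dilated k v (\<lambda>\<xi>. h \<xi> + c * h' \<xi>) = (\<lambda>\<xi>. dilated k v h \<xi> + c * dilated k v h' \<xi>)"
    by (auto simp: dilated_def algebra_simps)
  then show ?thesis
    using dilated_L1_L2(1)[OF psi h(1) v] dilated_L1_L2(1)[OF psi h(2) v]
    unfolding p wave_transform_eq_FT[OF v] by (simp add: FT_add FT_scale)
qed (simp add: wave_transform_def)

lemma L2plus_add_scale: "h \<in> L2plus \<Longrightarrow> h' \<in> L2plus \<Longrightarrow> (\<lambda>\<xi>. h \<xi> + c * h' \<xi>) \<in> L2plus"
  by (auto simp: L2plus_def intro!: L2_add L2_scale)

text \<open>Both claims are the case of the symbol 1. Integrability is recorded because the final
  argument splits the integral of a difference over \<open>nuG\<close>.\<close>

lemma wave_transform_isometry: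
  assumes psi: "L2 lborel (psi_hat k)" and h: "h \<in> L2plus" "h' \<in> L2plus"
  shows "L2inner nuG (wave_transform k h) (wave_transform k h') = L2inner lborel h h'"
    and "integrable nuG (\<lambda>p. wave_transform k h p * cnj (wave_transform k h' p))"
proof -
  have L: "L2 lborel h" "L2 lborel h'" and z: "\<And>\<xi>. \<xi> \<le> 0 \<Longrightarrow> h \<xi> = 0"
    using h by (auto simp: L2plus_def)
  have 1: "(\<lambda>v::real. 1::complex) \<in> borel_measurable lborel" "\<And>v::real. cmod 1 \<le> 1" by auto
  have "gamma_ak (\<lambda>_. 1) k \<xi> * h \<xi> * cnj (h' \<xi>) = h \<xi> * cnj (h' \<xi>)" for \<xi>
  proof (cases "\<xi> > 0")
    case True
    then show ?thesis by (simp add: gamma_ak_eq_kern kern_integral(2))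
  qed (simp add: z)
  note g = this
  have "L2inner nuG (\<lambda>p. 1 * wave_transform k h p) (wave_transform k h') = L2inner lborel h h'"
    using toeplitz_form[OF psi L 1 z] unfolding g by (simp add: L2inner_def)
  then show "L2inner nuG (wave_transform k h) (wave_transform k h') = L2inner lborel h h'" by simp
  show "integrable nuG (\<lambda>p. wave_transform k h p * cnj (wave_transform k h' p))"
    using integrable_toeplitz_form[OF psi L 1] by simp
qed

text \<open>The isometry, applied to the difference, whose transform is identically 0. It makes a
  chosen preimage unique up to null sets.\<close>

lemma wave_transform_inj_AE:
  assumes psi: "L2 lborel (psi_hat k)" and h: "h \<in> L2plus" "h' \<in> L2plus"
    and eq: "wave_transform k h = wave_transform k h'"
  shows "AE \<xi> in lborel. h \<xi> = h' \<xi>"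
proof -
  let ?d = "\<lambda>\<xi>. h \<xi> + (-1) * h' \<xi>"
  have d: "?d \<in> L2plus" by (rule L2plus_add_scale[OF h])
  have L: "L2 lborel h" "L2 lborel h'" "L2 lborel ?d" using h d by (auto simp: L2plus_def)
  have "wave_transform k ?d = (\<lambda>_. 0)"
    unfolding wave_transform_add_scale[OF psi L(1,2), abs_def] eq by simp
  then have "complex_of_real (sqn lborel ?d) = 0"
    using wave_transform_isometry(1)[OF psi d d] unfolding L2inner_self by (simp add: sqn_def)
  then have "AE \<xi> in lborel. ?d \<xi> = 0" by (intro sqn_eq_0D L) simp
  then show ?thesis by eventually_elim simp
qed

section \<open>Passage between the half-line and the real line\<close>

lemma L2_Rplus:
  assumes "L2 lborel h"
  shows "L2 Rplus h"
proof -
  have "set_integrable lborel {0<..} (\<lambda>x. (cmod (h x))^2)"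
    using set_integrable_subset[of lborel UNIV "\<lambda>x. (cmod (h x))^2" "{0<..}"] L2_integrable[OF assms]
    by (simp add: set_integrable_def)
  then show ?thesis
    using assms unfolding L2_def Rplus_def set_integrable_def
    by (auto simp: integrable_restrict_space intro: measurable_restrict_space1)
qed

lemma L2inner_Rplus:
  assumes "h \<in> L2plus"
  shows "L2inner Rplus h h' = L2inner lborel h h'"
  unfolding L2inner_def Rplus_def using assms
  by (subst integral_restrict_space)
     (auto simp: L2plus_def indicator_def intro!: Bochner_Integration.integral_cong)

lemma AE_Rplus: "(AE \<xi> in lborel. \<xi> > 0 \<longrightarrow> P \<xi>) \<Longrightarrow> AE \<xi> in Rplus. P \<xi>"
  unfolding Rplus_def by (subst AE_restrict_space_iff) auto

lemma L2plus_extend: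
  assumes "L2 Rplus h"
  shows "(\<lambda>\<xi>. if \<xi> > 0 then h \<xi> else 0) \<in> L2plus"
proof -
  have m: "h \<in> borel_measurable (restrict_space lborel {0<..})"
    and i: "integrable (restrict_space lborel {0<..}) (\<lambda>x. (cmod (h x))^2)"
    using assms unfolding L2_def Rplus_def by blast+
  have "(\<lambda>\<xi>. if \<xi> > 0 then h \<xi> else 0) \<in> borel_measurable lborel"
    using measurable_restrict_space_iff[of "{0<..}" lborel 0 borel h] m by simp
  moreover have "integrable lborel (\<lambda>x. (cmod (if x > 0 then h x else 0))^2)"
  proof -
    have "(\<lambda>x. (cmod (if x > 0 then h x else 0))^2) = (\<lambda>x. indicator {0<..} x *\<^sub>R (cmod (h x))^2)"
      by (auto simp: indicator_def)
    then show ?thesis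
      using integrable_restrict_space[of "{0<..}" lborel "\<lambda>x. (cmod (h x))^2"] i by simp
  qed
  ultimately show ?thesis
    unfolding L2plus_def L2_def mem_Collect_eq by (intro conjI allI impI) (assumption+, simp)
qed

text \<open>The symbol is averaged against a probability density in \<open>v\<close>, so its bound
  is preserved.\<close>

lemma gamma_ak_bounded:
  fixes a :: "real \<Rightarrow> complex"
  assumes [measurable]: "a \<in> borel_measurable lborel" and a: "\<And>v. cmod (a v) \<le> C" and \<xi>: "\<xi> > 0"
  shows "cmod (gamma_ak a k \<xi>) \<le> C"
proof -
  have C: "0 \<le> C" using a[of 0] norm_ge_zero order_trans by blast
  have "cmod (gamma_ak a k \<xi>) \<le> (LINT v|lborel. cmod (a v * of_real (kern k \<xi> v)))"
    unfolding gamma_ak_eq_kern[OF \<xi>] by (rule integral_norm_bound)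
  also have "\<dots> \<le> (LINT v|lborel. C * kern k \<xi> v)"
  proof (rule integral_mono)
    show *: "integrable lborel (\<lambda>v. C * kern k \<xi> v)"
      using kern_integral(1)[OF \<xi>] by simp
    have le: "cmod (a v * of_real (kern k \<xi> v)) \<le> C * kern k \<xi> v" for v
      by (auto simp: norm_mult kern_nonneg intro!: mult_right_mono a)
    show "integrable lborel (\<lambda>v. cmod (a v * of_real (kern k \<xi> v)))"
      by (rule Bochner_Integration.integrable_bound[OF *])
        (use le kern_integral(1)[OF \<xi>] in \<open>auto intro!: order_trans[OF _ abs_ge_self]\<close>)
    show "cmod (a v * of_real (kern k \<xi> v)) \<le> C * kern k \<xi> v" for v by (rule le)
  qed
  also have "\<dots> = C" using kern_integral(2)[OF \<xi>] by simp
  finally show ?thesis .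
qed

lemma gamma_ak_measurable:
  fixes a :: "real \<Rightarrow> complex"
  assumes [measurable]: "a \<in> borel_measurable lborel"
  shows "gamma_ak a k \<in> borel_measurable lborel"
  unfolding gamma_ak_def[abs_def] set_lebesgue_integral_def by measurable

theorem mainTheorem1:
  fixes k :: nat and a :: "real \<Rightarrow> complex" and psi :: "real \<Rightarrow> complex"
  assumes "a \<in> borel_measurable (restrict_space borel {0<..})"
    and "\<exists>C. \<forall>v>0. cmod (a v) \<le> C"
    and "is_fourier psi (psi_hat k)"
  shows "unitarily_equiv_mult (wavelet_space psi)
           (calderon_toeplitz (wavelet_space psi) a) (gamma_ak a k)"
proof -
  let ?W = "wave_transform k"
  let ?A = "wavelet_space psi"
  have A: "?A = ?W ` L2plus" by (rule wavelet_space_eq[OF assms(3)])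
  have psi: "L2 lborel (psi_hat k)" using assms(3) by (simp add: is_fourier_def)
  \<comment> \<open>Measurability and boundedness of \<open>a\<close> are given on the positive axis
    only. Extension by 0 makes both global and changes neither \<open>gamma_ak\<close> at positive
    \<open>\<xi>\<close> nor the products with functions of the space.\<close>
  define b where "b v = (if v > 0 then a v else 0)" for v
  have b: "b \<in> borel_measurable lborel"
    using measurable_restrict_space_iff[of "{0<..}" borel 0 borel a] assms(1) by (simp add: b_def[abs_def])
  obtain C where C: "\<forall>v>0. cmod (a v) \<le> C" using assms(2) by blast
  have bC: "cmod (b v) \<le> max C 0" for v
    using C by (cases "v > 0") (auto simp: b_def intro: max.coboundedI1)
  have gamma_b: "gamma_ak a k \<xi> = gamma_ak b k \<xi>" if "\<xi> > 0" for \<xi>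
    unfolding gamma_ak_def set_lebesgue_integral_def using that
    by (intro Bochner_Integration.integral_cong) (auto simp: b_def indicator_def)
  \<comment> \<open>The inverse of the wavelet transform, by choice. Preimages agree only almost
    everywhere, so \<open>U\<close> is linear only in that sense.\<close>
  define U where "U F = (SOME h. h \<in> L2plus \<and> ?W h = F)" for F
  have U: "U F \<in> L2plus" "?W (U F) = F" if "F \<in> ?A" for F
  proof -
    from that have "\<exists>h. h \<in> L2plus \<and> ?W h = F" unfolding A by blast
    from someI_ex[OF this] show "U F \<in> L2plus" "?W (U F) = F" by (simp_all add: U_def)
  qed
  have UW: "AE \<xi> in lborel. U F \<xi> = h \<xi>" if "h \<in> L2plus" "F = ?W h" for h F
    by (rule wave_transform_inj_AE[OF psi]) (use that U[of F] A in auto)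
  have L: "L2 lborel (U F)" if "F \<in> ?A" for F using U(1)[OF that] by (simp add: L2plus_def)
  show ?thesis
    unfolding unitarily_equiv_mult_def
  proof (intro exI[of _ U] conjI ballI allI impI)
    show "L2 Rplus (U F)" if "F \<in> ?A" for F
      by (rule L2_Rplus[OF L[OF that]])
    show "AE \<xi> in Rplus. U (\<lambda>p. F p + c * F' p) \<xi> = U F \<xi> + c * U F' \<xi>"
      if F: "F \<in> ?A" "F' \<in> ?A" for F F' c
    proof -
      have "(\<lambda>p. F p + c * F' p) = ?W (\<lambda>\<xi>. U F \<xi> + c * U F' \<xi>)"
        unfolding wave_transform_add_scale[OF psi L[OF F(1)] L[OF F(2)], abs_def] U(2)[OF F(1)] U(2)[OF F(2)] ..
      from UW[OF L2plus_add_scale[OF U(1)[OF F(1)] U(1)[OF F(2)]] this]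
      show ?thesis by (intro AE_Rplus) auto
    qed
    show "L2inner Rplus (U F) (U F') = L2inner nuG F F'" if F: "F \<in> ?A" "F' \<in> ?A" for F F'
      unfolding L2inner_Rplus[OF U(1)[OF F(1)]]
      using wave_transform_isometry(1)[OF psi U(1)[OF F(1)] U(1)[OF F(2)]] U(2)[OF F(1)] U(2)[OF F(2)] by simp
    show "\<exists>F\<in>?A. AE \<xi> in Rplus. U F \<xi> = h \<xi>" if h: "L2 Rplus h" for h
    proof
      let ?h = "\<lambda>\<xi>. if \<xi> > 0 then h \<xi> else 0"
      show "?W ?h \<in> ?A" using L2plus_extend[OF h] A by blast
      have "AE \<xi> in lborel. U (?W ?h) \<xi> = ?h \<xi>" by (rule UW[OF L2plus_extend[OF h] refl])
      then show "AE \<xi> in Rplus. U (?W ?h) \<xi> = h \<xi>"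
        by (intro AE_Rplus, eventually_elim) simp
    qed
    show "AE \<xi> in Rplus. U TF \<xi> = gamma_ak a k \<xi> * U F \<xi>"
      if F: "F \<in> ?A" and T: "calderon_toeplitz ?A a F TF" for F TF
    proof -
      have TF: "TF \<in> ?A" and orth: "\<And>G. G \<in> ?A \<Longrightarrow> L2inner nuG (\<lambda>p. a (snd p) * F p - TF p) G = 0"
        using T by (auto simp: calderon_toeplitz_def is_proj_def)
      \<comment> \<open>The function that \<open>U TF\<close> should equal. The factor is cut to 0
        off the positive axis because \<open>gamma_ak_bounded\<close> covers positive
        \<open>\<xi>\<close> only.\<close>
      define g where "g \<xi> = (if \<xi> > 0 then gamma_ak b k \<xi> else 0) * U F \<xi>" for \<xi>
      have g: "g \<in> L2plus"
      proof -
        have [measurable]: "gamma_ak b k \<in> borel_measurable lborel" by (rule gamma_ak_measurable[OF b])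
        have "L2 lborel g" unfolding g_def
          by (rule L2_bounded_mult[OF L[OF F], where B="max C 0"]) (auto intro!: gamma_ak_bounded[OF b bC])
        then show ?thesis by (simp add: L2plus_def g_def)
      qed
      \<comment> \<open>The deviation of the actual answer from the expected one. Its wavelet
        transform lies in the space, so orthogonality can be tested on it, and the outcome is the
        squared norm of \<open>D\<close>.\<close>
      define D where "D \<xi> = g \<xi> + (-1) * U TF \<xi>" for \<xi>
      have D: "D \<in> L2plus" unfolding D_def[abs_def] by (rule L2plus_add_scale[OF g U(1)[OF TF]])
      then have LD: "L2 lborel D" by (simp add: L2plus_def)
      \<comment> \<open>Off the half-plane \<open>F\<close> is 0, so \<open>a\<close> and
        \<open>b\<close> give the same product.\<close>
      have aF: "a (snd p) * F p = b (snd p) * ?W (U F) p" for p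
      proof (cases "snd p > 0")
        case False
        have "F p = ?W (U F) p" unfolding U(2)[OF F] ..
        with False show ?thesis by (simp add: wave_transform_def)
      qed (simp add: b_def U(2)[OF F])
      have "0 = L2inner nuG (\<lambda>p. a (snd p) * F p - TF p) (?W D)"
        using orth[of "?W D"] D A by auto
      also have "\<dots> = (LINT p|nuG. b (snd p) * ?W (U F) p * cnj (?W D p) - ?W (U TF) p * cnj (?W D p))"
        unfolding L2inner_def aF U(2)[OF TF] by (simp add: left_diff_distrib)
      also have "\<dots> = L2inner nuG (\<lambda>p. b (snd p) * ?W (U F) p) (?W D) - L2inner nuG (?W (U TF)) (?W D)"
        unfolding L2inner_def
        by (intro Bochner_Integration.integral_diff integrable_toeplitz_form[OF psi L[OF F] LD b bC]
          wave_transform_isometry(2)[OF psi U(1)[OF TF] D])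
      also have "L2inner nuG (\<lambda>p. b (snd p) * ?W (U F) p) (?W D) = (LINT \<xi>|lborel. gamma_ak b k \<xi> * U F \<xi> * cnj (D \<xi>))"
        by (rule toeplitz_form[OF psi L[OF F] LD b bC]) (use U(1)[OF F] in \<open>auto simp: L2plus_def\<close>)
      also have "\<dots> = L2inner lborel g D"
        unfolding L2inner_def
        by (intro Bochner_Integration.integral_cong) (use U(1)[OF F] in \<open>auto simp: g_def L2plus_def\<close>)
      also have "L2inner nuG (?W (U TF)) (?W D) = L2inner lborel (U TF) D"
        by (rule wave_transform_isometry(1)[OF psi U(1)[OF TF] D])
      also have "L2inner lborel g D - L2inner lborel (U TF) D = L2inner lborel D D"
      proof -
        have "(\<lambda>\<xi>. g \<xi> - U TF \<xi>) = D" by (simp add: D_def fun_eq_iff)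
        then show ?thesis
          using L2inner_diff_left[of lborel g "U TF" D] g LD L[OF TF] by (simp add: L2plus_def)
      qed
      finally have "sqn lborel D = 0" by (simp add: L2inner_self)
      from sqn_eq_0D[OF LD this] have "AE \<xi> in lborel. \<xi> > 0 \<longrightarrow> U TF \<xi> = gamma_ak a k \<xi> * U F \<xi>"
        by eventually_elim (auto simp: D_def g_def gamma_b)
      then show ?thesis by (rule AE_Rplus)
    qed
  qed
qed

end
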